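(* Let $G$ be a $\sigma$-compact locally compact abelian group, $(X,G)$ a topological dynamical system with $X$ metrizable, $m$ an ergodic $G$-invariant probability measure on $X$, and $\mathcal{A}=(A_n)$ a Følner sequence in $G$. Then: (a) If the pointwise ergodic theorem holds along $\mathcal{A}$, then the set of Wiener–Wintner points of $(X,G,m)$ with respect to $\mathcal{A}$ has full measure in $X$. (b) $\mathcal{A}$ has a subsequence $\mathcal{A}'$ such that the set of Wiener–Wintner points of $(X,G,m)$ with respect to $\mathcal{A}'$ has full measure.
   Context: $G$ is written additively, with a fixed Haar measure; $|A|$ is the Haar measure of $A\subseteq G$ and $dt$ denotes integration against it. $\widehat{G}$ is the dual group (continuous homomorphisms $G\to\{w\in\mathbb{C}:|w|=1\}$). A Følner sequence is a sequence $(A_n)$ of open relatively compact subsets of $G$ (in particular $|A_n|>0$) with $\lim_n|A_n\triangle(t+A_n)|/|A_n|=0$ for all $t\in G$. A topological dynamical system $(X,G)$ is a compact space $X$ with a continuous action $G\times X\to X$, $(t,x)\mapsto t.x$. $m$ is ergodic if every measurable $f:X\to\mathbb{C}$ such that for each $t\in G$ one has $f(t.\,\cdot)=f$ $m$-a.e. is constant $m$-a.e. The pointwise ergodic theorem holds along $\mathcal{A}$ if for each $f\in\mathcal{L}^1(X,m)$ there is $X_0\subseteq X$ with $m(X_0)=1$ such that $\lim_n\frac{1}{|A_n|}\int_{A_n}f(t.x)\,dt=\int_Xf\,dm$ for all $x\in X_0$. An eigenfunction to $\chi\in\widehat{G}$ is a nonzero $f\in L^2(X,m)$ with $f(t\,\cdot)=\chi(t)f$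 in $L^2(X,m)$ for all $t\in G$; together with $0$ these form the eigenspace of $\chi$. $\mathbb{S}$ is the set of $\chi\in\widehat{G}$ having an eigenfunction. $\langle f,g\rangle=\int_Xf\overline{g}\,dm$. A point $x\in X$ is a Wiener–Wintner point of $(X,G,m)$ with respect to $\mathcal{A}$ if there is a set $B\subseteq\mathcal{L}^2(X,m)$ (square-integrable functions) consisting of eigenfunctions such that: (1) for each $\chi\in\mathbb{S}$ the set of $e\in B$ that are eigenfunctions to $\chi$ is an orthonormal basis of the eigenspace of $\chi$; (2) for all $f\in C(X)$ and $e\in B$ with corresponding eigenvalue $\chi_e$ the limit $\lim_n\frac{1}{|A_n|}\int_{A_n}f(t.x)\overline{\chi_e(t)}\,dt$ exists and equals $\langle f,e\rangle$. *)

theory Defs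
  imports "HOL-Analysis.Analysis" "HOL-Probability.Probability"
begin

definition sigma_compact_space :: "'a::topological_space itself \<Rightarrow> bool" where
  "sigma_compact_space _ \<longleftrightarrow>
     (\<exists>K :: nat \<Rightarrow> 'a set. (\<forall>n. compact (K n)) \<and> (\<Union>n. K n) = UNIV)"

(* A nonzero translation-invariant Radon measure on the Borel sets.  The group need not be
   second countable, so regularity is part of the definition and not a consequence. *)
definition haar_measure ::
    "'g::{topological_ab_group_add,t2_space} measure \<Rightarrow> bool" where
  "haar_measure \<mu> \<longleftrightarrow>
     sets \<mu> = sets borel \<and>
     emeasure \<mu> UNIV \<noteq> 0 \<and>
     (\<forall>t. \<forall>S\<in>sets borel. emeasure \<mu> ((+) t ` S) = emeasure \<mu> S) \<and>
     (\<forall>K. compact K \<longrightarrow> emeasure \<mu> K < \<infinity>) \<and>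
     (\<forall>S\<in>sets borel. emeasure \<mu> S = (INF U\<in>{U. open U \<and> S \<subseteq> U}. emeasure \<mu> U)) \<and>
     (\<forall>U. open U \<longrightarrow> emeasure \<mu> U = (SUP K\<in>{K. compact K \<and> K \<subseteq> U}. emeasure \<mu> K))"

definition dual_group :: "('g::topological_ab_group_add \<Rightarrow> complex) set" where
  "dual_group = {\<xi>. continuous_on UNIV \<xi> \<and> (\<forall>t. cmod (\<xi> t) = 1) \<and>
                    (\<forall>s t. \<xi> (s + t) = \<xi> s * \<xi> t)}"

definition folner_sequence ::
    "'g::topological_ab_group_add measure \<Rightarrow> (nat \<Rightarrow> 'g set) \<Rightarrow> bool" where
  "folner_sequence \<mu> A \<longleftrightarrow>
     (\<forall>n. open (A n) \<and> compact (closure (A n)) \<and> measure \<mu> (A n) > 0) \<and>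
     (\<forall>t. (\<lambda>n. measure \<mu> (sym_diff (A n) ((+) t ` A n)) / measure \<mu> (A n)) \<longlonglongrightarrow> 0)"

definition set_average :: "'g measure \<Rightarrow> 'g set \<Rightarrow> ('g \<Rightarrow> complex) \<Rightarrow> complex" where
  "set_average \<mu> S g = (LINT t:S|\<mu>. g t) /\<^sub>R measure \<mu> S"

definition topological_dynamical_system ::
    "('g::topological_ab_group_add \<Rightarrow> 'x::topological_space \<Rightarrow> 'x) \<Rightarrow> bool" where
  "topological_dynamical_system act \<longleftrightarrow>
     compact (UNIV :: 'x set) \<and>
     continuous_on UNIV (\<lambda>(t, x). act t x) \<and>
     (\<forall>x. act 0 x = x) \<and>
     (\<forall>s t x. act (s + t) x = act s (act t x))"

definition invariant_measure ::
    "('g \<Rightarrow> 'x \<Rightarrow> 'x) \<Rightarrow> 'x::topological_space measure \<Rightarrow> bool" where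
  "invariant_measure act m \<longleftrightarrow> sets m = sets borel \<and> (\<forall>t. distr m borel (act t) = m)"

definition ergodic_measure :: "('g \<Rightarrow> 'x \<Rightarrow> 'x) \<Rightarrow> 'x measure \<Rightarrow> bool" where
  "ergodic_measure act m \<longleftrightarrow>
     (\<forall>f :: 'x \<Rightarrow> complex. f \<in> borel_measurable m \<longrightarrow>
        (\<forall>t. AE x in m. f (act t x) = f x) \<longrightarrow> (\<exists>c. AE x in m. f x = c))"

(* Bochner integrals of non-integrable functions are 0 by convention, so the existence of the
   orbit integrals on X0 is required explicitly.  A non-measurable set has measure 0, so
   "measure m X0 = 1" entails measurability of X0. *)
definition pointwise_ergodic_theorem ::
    "'g measure \<Rightarrow> ('g \<Rightarrow> 'x \<Rightarrow> 'x) \<Rightarrow> 'x measure \<Rightarrow> (nat \<Rightarrow> 'g set) \<Rightarrow> bool" where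
  "pointwise_ergodic_theorem \<mu> act m A \<longleftrightarrow>
     (\<forall>f :: 'x \<Rightarrow> complex. integrable m f \<longrightarrow>
        (\<exists>X0. measure m X0 = 1 \<and>
           (\<forall>x\<in>X0. (\<forall>n. set_integrable \<mu> (A n) (\<lambda>t. f (act t x))) \<and>
              (\<lambda>n. set_average \<mu> (A n) (\<lambda>t. f (act t x))) \<longlonglongrightarrow> (LINT x|m. f x))))"

text \<open>
  Elements of \<open>L\<^sup>2\<close> are represented by square-integrable functions; equality in \<open>L\<^sup>2\<close> is
  equality almost everywhere.
\<close>

definition square_integrable :: "'x measure \<Rightarrow> ('x \<Rightarrow> complex) set" where
  "square_integrable m = {f \<in> borel_measurable m. integrable m (\<lambda>x. (cmod (f x))\<^sup>2)}"

definition l2_inner :: "'x measure \<Rightarrow> ('x \<Rightarrow> complex) \<Rightarrow> ('x \<Rightarrow> complex) \<Rightarrow> complex" where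
  "l2_inner m f g = (LINT x|m. f x * cnj (g x))"

definition l2_norm :: "'x measure \<Rightarrow> ('x \<Rightarrow> complex) \<Rightarrow> real" where
  "l2_norm m f = sqrt (LINT x|m. (cmod (f x))\<^sup>2)"

definition eigenspace ::
    "('g \<Rightarrow> 'x \<Rightarrow> 'x) \<Rightarrow> 'x measure \<Rightarrow> ('g \<Rightarrow> complex) \<Rightarrow> ('x \<Rightarrow> complex) set" where
  "eigenspace act m \<xi> =
     {f \<in> square_integrable m. \<forall>t. AE x in m. f (act t x) = \<xi> t * f x}"

definition eigenfunction ::
    "('g \<Rightarrow> 'x \<Rightarrow> 'x) \<Rightarrow> 'x measure \<Rightarrow> ('g \<Rightarrow> complex) \<Rightarrow> ('x \<Rightarrow> complex) \<Rightarrow> bool" where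
  "eigenfunction act m \<xi> f \<longleftrightarrow> f \<in> eigenspace act m \<xi> \<and> \<not> (AE x in m. f x = 0)"

definition point_spectrum ::
    "('g::topological_ab_group_add \<Rightarrow> 'x \<Rightarrow> 'x) \<Rightarrow> 'x measure \<Rightarrow> ('g \<Rightarrow> complex) set" where
  "point_spectrum act m = {\<xi> \<in> dual_group. \<exists>f. eigenfunction act m \<xi> f}"

(* Orthonormal basis in the Hilbert space sense: orthonormal with L2-dense linear span in V.
   Distinct members of E are orthogonal unit vectors, so they represent distinct L2 classes. *)
definition orthonormal_basis ::
    "'x measure \<Rightarrow> ('x \<Rightarrow> complex) set \<Rightarrow> ('x \<Rightarrow> complex) set \<Rightarrow> bool" where
  "orthonormal_basis m E V \<longleftrightarrow>
     E \<subseteq> V \<and>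
     (\<forall>e\<in>E. \<forall>e'\<in>E. l2_inner m e e' = (if e = e' then 1 else 0)) \<and>
     (\<forall>f\<in>V. \<forall>\<epsilon>>0. \<exists>F c. finite F \<and> F \<subseteq> E \<and> l2_norm m (\<lambda>x. f x - (\<Sum>e\<in>F. c e * e x)) < \<epsilon>)"

(* An eigenfunction is nonzero, so the \<xi> attached to e in the last clause is unique. *)
definition wiener_wintner_point ::
    "'g::topological_ab_group_add measure \<Rightarrow> ('g \<Rightarrow> 'x::topological_space \<Rightarrow> 'x) \<Rightarrow>
     'x measure \<Rightarrow> (nat \<Rightarrow> 'g set) \<Rightarrow> 'x \<Rightarrow> bool" where
  "wiener_wintner_point \<mu> act m A x \<longleftrightarrow>
     (\<exists>B \<subseteq> square_integrable m.
        (\<forall>e\<in>B. \<exists>\<xi>\<in>dual_group. eigenfunction act m \<xi> e) \<and>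
        (\<forall>\<xi>\<in>point_spectrum act m.
           orthonormal_basis m {e\<in>B. eigenfunction act m \<xi> e} (eigenspace act m \<xi>)) \<and>
        (\<forall>f. continuous_on UNIV f \<longrightarrow>
           (\<forall>e\<in>B. \<forall>\<xi>\<in>dual_group. eigenfunction act m \<xi> e \<longrightarrow>
              (\<lambda>n. set_average \<mu> (A n) (\<lambda>t. f (act t x) * cnj (\<xi> t))) \<longlonglongrightarrow> l2_inner m f e)))"

end

theory Submission
  imports Defs
begin

text \<open>
  Ergodicity makes every eigenspace a line: if \<open>f\<close> is an eigenfunction then \<open>\<bar>f\<bar>\<close> is invariant,
  hence constant, so each \<open>\<xi>\<close> in the point spectrum has an eigenfunction \<open>e\<^sub>\<xi>\<close> of modulus one
  everywhere, and \<open>f \<cdot> cnj e\<^sub>\<xi>\<close> is invariant, hence constant, for every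
  other \<open>f\<close> in the eigenspace.  By Fubini, for
  almost every \<open>x\<close> the identity \<open>e\<^sub>\<xi>(t.x) = \<xi>(t) e\<^sub>\<xi>(x)\<close> holds for almost every \<open>t\<close>.  At such an \<open>x\<close>
  the twisted average of \<open>f\<close> along its orbit is an untwisted one, up to a constant:
  the average of \<open>f(t.x) cnj (\<xi>(t))\<close> equals \<open>e\<^sub>\<xi>(x)\<close> times the average of \<open>(f \<cdot> cnj e\<^sub>\<xi>)(t.x)\<close>.
  If the ergodic averages of \<open>f \<cdot> cnj e\<^sub>\<xi>\<close> converge at \<open>x\<close>, the twisted averages therefore converge to
  \<open>e\<^sub>\<xi>(x) \<integral> f \<cdot> cnj e\<^sub>\<xi>\<close>, which is the inner product of \<open>f\<close> with \<open>cnj (e\<^sub>\<xi>(x)) \<cdot> e\<^sub>\<xi>\<close>.  This is why the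
  orthonormal bases have to depend on the point: at \<open>x\<close> one uses the vectors
  \<open>cnj (e\<^sub>\<xi>(x)) \<cdot> e\<^sub>\<xi>\<close> (\<open>twisted_average_eq\<close>, \<open>wiener_wintner_test_functions\<close>).

  To collect a single null set, only countably many functions may be tested.  The
  point spectrum is countable, because distinct eigenfunctions are orthogonal and \<open>X\<close> has a countable
  base (\<open>countable_point_spectrum\<close>).  Continuous functions are replaced by indicators of
  \<^emph>\<open>cells\<close>, the differences of finite intersections and finite unions of basic open sets:
  there are countably many of them, and their linear combinations approximate every continuous function
  uniformly (\<open>continuous_uniform_approx_basis_cells\<close>).  So it suffices that the averages
  of the countably many bounded functions \<open>1\<^sub>P \<cdot> cnj e\<^sub>\<xi>\<close> converge almost everywhere.

  For the first claim this is an instance of the pointwise ergodic theorem.  For the second claim it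
  holds along a subsequence: the averages converge in \<open>L\<^sup>1\<close> (\<open>mean_ergodic_L1\<close>), and a
  diagonal subsequence makes the \<open>L\<^sup>1\<close> errors of all test functions summable
  (\<open>pointwise_ergodic_subsequence\<close>).  The mean ergodic theorem is obtained from the parallelogram law:
  convex combinations of translates of \<open>h\<close> that nearly minimise the \<open>L\<^sup>2\<close> norm form
  a Cauchy sequence with an invariant, hence constant, limit, while the Foelner property makes the
  averages of \<open>h\<close> and of such a combination asymptotically equal.
\<close>

section \<open>Countable bases, cells and approximation of continuous functions\<close>

text \<open>
  Cover \<open>X\<close> by finitely many balls of radius \<open>1/(n+1)\<close> for each \<open>n\<close>; all these balls together form a base.
\<close>

lemma compact_metrizable_countable_basis:
  assumes comp: "compact (UNIV :: 'x::topological_space set)"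
    and metr: "metrizable_space (euclidean :: 'x::topological_space topology)"
  obtains B :: "'x::topological_space set set" where "countable B" "topological_basis B"
proof -
  obtain M d where M: "Metric_space M d" and top: "euclidean = Metric_space.mtopology M (d :: 'x \<Rightarrow> 'x \<Rightarrow> real)"
    using metr unfolding metrizable_space_def by blast
  interpret Metric_space M d by (rule M)
  have M_UNIV: "M = UNIV"
    using top topspace_mtopology by (metis topspace_euclidean)
  have open_mball': "open (mball x r)" for x r
    using openin_mball[of x r] top by (metis open_openin)
  have "\<exists>F. finite F \<and> (\<Union>x\<in>F. mball x (1 / real (Suc n))) = UNIV" for n
  proof -
    have "x \<in> mball x (1 / real (Suc n))" for x
      by (subst centre_in_mball_iff) (simp_all add: M_UNIV)
    then have "UNIV \<subseteq> (\<Union>x\<in>UNIV. mball x (1 / real (Suc n)))"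
      by blast
    then obtain F where "finite F" "UNIV \<subseteq> (\<Union>x\<in>F. mball x (1 / real (Suc n)))"
      using compactE_image[OF comp, of UNIV "\<lambda>x. mball x (1 / real (Suc n))"] open_mball' by metis
    then show ?thesis by blast
  qed
  then obtain F where F: "\<And>n. finite (F n)" "\<And>n. (\<Union>x\<in>F n. mball x (1 / real (Suc n))) = UNIV"
    by metis
  define B where "B = (\<Union>n. (\<lambda>x. mball x (1 / real (Suc n))) ` F n)"
  have "countable B"
    unfolding B_def by (intro countable_UN countable_image) (auto intro: countable_finite F)
  moreover have "topological_basis B"
  proof (rule topological_basisI)
    show "open b" if "b \<in> B" for b
      using that open_mball' by (auto simp: B_def)
    fix U x assume U: "open U" "(x::'x) \<in> U"
    then have "openin mtopology U" by (metis open_openin top)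
    then obtain r where r: "r > 0" "mball x r \<subseteq> U"
      using U(2) openin_mtopology by blast
    obtain n where n: "2 / r < real (Suc n)"
      using reals_Archimedean2 less_trans lessI of_nat_less_iff by meson
    obtain y where y: "y \<in> F n" "x \<in> mball y (1 / real (Suc n))"
      using F(2)[of n] by blast
    have small: "2 * (1 / real (Suc n)) < r"
      using n r(1) by (simp add: field_simps)
    have "mball y (1 / real (Suc n)) \<subseteq> mball x r"
    proof
      fix z assume z: "z \<in> mball y (1 / real (Suc n))"
      have "d x z \<le> d x y + d y z" by (intro triangle) (auto simp: M_UNIV)
      then have "d x z < r" using y(2) z small by (auto simp: commute)
      then show "z \<in> mball x r" unfolding in_mball by (simp add: M_UNIV)
    qed
    then show "\<exists>b\<in>B. x \<in> b \<and> b \<subseteq> U"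
      using y r(2) unfolding B_def by blast
  qed
  ultimately show thesis by (rule that)
qed

text \<open>
  In the product of two arbitrary spaces an open set may fail to lie in the product of the Borel
  \<open>\<sigma>\<close>-algebras.  A countable base of one factor is enough: an open set \<open>W\<close> is the union over
  basic sets \<open>b\<close> of the rectangles \<open>T b \<times> b\<close>, where \<open>T b\<close> is the largest open set with
  \<open>T b \<times> b \<subseteq> W\<close>.  This is what makes the action of a group without countable base jointly measurable.
\<close>

lemma continuous_on_UNIV_measurable_pair:
  fixes f :: "'g::topological_space \<times> 'x::topological_space \<Rightarrow> 'y::topological_space"
  assumes B: "countable B" "topological_basis (B :: 'x set set)"
    and f: "continuous_on UNIV f"
  shows "f \<in> borel \<Otimes>\<^sub>M borel \<rightarrow>\<^sub>M borel"
proof (rule borel_measurableI)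
  fix V :: "'y set" assume "open V"
  then have W: "open (f -` V)" using f by (simp add: open_vimage)
  define T where "T b = \<Union>{S. open S \<and> S \<times> b \<subseteq> f -` V}" for b
  have T: "open (T b)" for b unfolding T_def by auto
  have "f -` V = (\<Union>b\<in>B. T b \<times> b)"
  proof (intro set_eqI iffI)
    fix z assume "z \<in> f -` V"
    then obtain P Q where PQ: "open P" "open Q" "z \<in> P \<times> Q" "P \<times> Q \<subseteq> f -` V"
      using open_prod_elim[OF W] by metis
    obtain b where b: "b \<in> B" "snd z \<in> b" "b \<subseteq> Q"
      using topological_basisE[OF B(2) PQ(2)] PQ(3) by (metis mem_Times_iff)
    have "P \<subseteq> T b" unfolding T_def using PQ b by blast
    then show "z \<in> (\<Union>b\<in>B. T b \<times> b)"
      using b PQ(3) by (force simp: mem_Times_iff)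
  next
    fix z assume "z \<in> (\<Union>b\<in>B. T b \<times> b)"
    then show "z \<in> f -` V" unfolding T_def by auto
  qed
  also have "\<dots> \<in> sets (borel \<Otimes>\<^sub>M borel)"
    using B(1) T topological_basis_open[OF B(2)]
    by (intro sets.countable_UN'' pair_measureI borel_open) auto
  finally show "f -` V \<inter> space (borel \<Otimes>\<^sub>M borel) \<in> sets (borel \<Otimes>\<^sub>M borel)"
    by (simp add: space_pair_measure)
qed

text \<open>
  Differences, and not just finite intersections of basic sets, are used because finite open
  covers have to be refined to partitions.  The family is still countable and stable under
  intersection.
\<close>

definition basis_cells :: "'x set set \<Rightarrow> 'x set set" where
  "basis_cells B = (\<lambda>(F, F'). \<Inter>F - \<Union>F') ` (Collect (\<lambda>F. finite F \<and> F \<subseteq> B) \<times> Collect (\<lambda>F. finite F \<and> F \<subseteq> B))"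

lemma basis_cellsI: "finite F \<Longrightarrow> F \<subseteq> B \<Longrightarrow> finite F' \<Longrightarrow> F' \<subseteq> B \<Longrightarrow> \<Inter>F - \<Union>F' \<in> basis_cells B"
  unfolding basis_cells_def by force

lemma countable_basis_cells: "countable B \<Longrightarrow> countable (basis_cells B)"
  unfolding basis_cells_def by (intro countable_image countable_SIGMA countable_Collect_finite_subset)

lemma basis_cells_borel:
  assumes "topological_basis B" "P \<in> basis_cells B" shows "P \<in> sets borel"
proof -
  obtain F F' where F: "finite F" "F \<subseteq> B" "finite F'" "F' \<subseteq> B" "P = \<Inter>F - \<Union>F'"
    using assms(2) unfolding basis_cells_def by auto
  have "open (\<Inter>F)" "open (\<Union>F')"
    using F topological_basis_open[OF assms(1)] by (auto intro!: open_Inter)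
  then show ?thesis using F(5) by auto
qed

lemma Int_stable_basis_cells: "Int_stable (basis_cells B)"
proof (rule Int_stableI)
  fix a b assume "a \<in> basis_cells B" "b \<in> basis_cells B"
  then obtain F F' G G' where F: "finite F" "F \<subseteq> B" "finite F'" "F' \<subseteq> B" "a = \<Inter>F - \<Union>F'"
    and G: "finite G" "G \<subseteq> B" "finite G'" "G' \<subseteq> B" "b = \<Inter>G - \<Union>G'"
    unfolding basis_cells_def by auto
  have "a \<inter> b = \<Inter>(F \<union> G) - \<Union>(F' \<union> G')" using F(5) G(5) by auto
  then show "a \<inter> b \<in> basis_cells B"
    using F G by (metis basis_cellsI Un_subset_iff finite_UnI)
qed

lemma sigma_sets_basis_cells:
  assumes "countable B" "topological_basis B"
  shows "sigma_sets UNIV (basis_cells B) = sets borel"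
proof
  show "sigma_sets UNIV (basis_cells B) \<subseteq> sets borel"
    using sets.sigma_sets_subset[of "basis_cells B" borel] basis_cells_borel[OF assms(2)] by auto
  have "B \<subseteq> basis_cells B"
    using basis_cellsI[of "{b}" B "{}" for b] by auto
  moreover have "sets borel = sigma_sets UNIV B"
    by (subst borel_eq_countable_basis[OF assms]) (rule sets_measure_of, simp)
  ultimately show "sets borel \<subseteq> sigma_sets UNIV (basis_cells B)"
    using sigma_sets_mono' by metis
qed

text \<open>
  Finitely many basic sets on which \<open>f\<close> varies by at most \<open>\<epsilon>\<close> cover the compact space;
  removing from each one its predecessors turns them into a partition into cells, and \<open>f\<close> is
  replaced on each cell by its value at a point of the corresponding basic set.
\<close>

lemma continuous_uniform_approx_basis_cells:
  fixes f :: "'x::topological_space \<Rightarrow> complex"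
  assumes comp: "compact (UNIV :: 'x set)" and B: "topological_basis B"
    and f: "continuous_on UNIV f" and "\<epsilon> > 0"
  obtains n :: nat and P a where "\<And>i. i < n \<Longrightarrow> P i \<in> basis_cells B"
    "\<And>x. cmod (f x - (\<Sum>i<n. a i * indicator (P i) x)) \<le> \<epsilon>"
proof -
  have "\<exists>b\<in>B. x \<in> b \<and> (\<forall>y\<in>b. cmod (f y - f x) \<le> \<epsilon>)" for x
  proof -
    have "open (f -` ball (f x) \<epsilon>)" using f by (simp add: open_vimage)
    then obtain b where "b \<in> B" "x \<in> b" "b \<subseteq> f -` ball (f x) \<epsilon>"
      using topological_basisE[OF B, of "f -` ball (f x) \<epsilon>" x] \<open>\<epsilon> > 0\<close> by auto
    then show ?thesis by (intro bexI[of _ b]) (force simp: dist_norm norm_minus_commute)+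
  qed
  then obtain U where U: "\<And>x. U x \<in> B" "\<And>x. x \<in> U x" "\<And>x y. y \<in> U x \<Longrightarrow> cmod (f y - f x) \<le> \<epsilon>"
    by metis
  obtain C where C: "finite C" "UNIV \<subseteq> (\<Union>x\<in>C. U x)"
    using compactE_image[OF comp, of UNIV U] U topological_basis_open[OF B] by (metis UNIV_I UN_I subsetI)
  obtain p and n :: nat where p: "C = p ` {i. i < n}"
    using finite_imp_nat_seg_image_inj_on[OF C(1)] by blast
  define P where "P i = \<Inter>{U (p i)} - \<Union>((\<lambda>j. U (p j)) ` {..<i})" for i
  have P: "P i \<in> basis_cells B" for i
    unfolding P_def using U(1) by (intro basis_cellsI) auto
  have "cmod (f x - (\<Sum>i<n. f (p i) * indicator (P i) x)) \<le> \<epsilon>" for x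
  proof -
    \<comment> \<open>\<open>P i\<close> is the only cell of the partition that contains \<open>x\<close>.\<close>
    define i where "i = (LEAST i. x \<in> U (p i))"
    obtain k where k: "k < n" "x \<in> U (p k)" using C(2) p by auto
    have i: "x \<in> U (p i)" "i < n" and least: "\<And>j. x \<in> U (p j) \<Longrightarrow> i \<le> j"
      unfolding i_def using LeastI[of "\<lambda>i. x \<in> U (p i)"] Least_le[of "\<lambda>i. x \<in> U (p i)"] k
      by (auto intro: le_less_trans)
    have "x \<in> P j \<longleftrightarrow> j = i" for j
    proof
      assume "x \<in> P j"
      then have "x \<in> U (p j)" "\<And>k. k < j \<Longrightarrow> x \<notin> U (p k)" unfolding P_def by auto
      then show "j = i" using i(1) least by (metis le_neq_implies_less)
    next
      assume "j = i"
      then show "x \<in> P j" using i(1) least unfolding P_def by (auto dest: leD)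
    qed
    then have "(\<Sum>j<n. f (p j) * indicator (P j) x) = (\<Sum>j<n. if j = i then f (p i) else 0)"
      by (intro sum.cong) (auto simp: indicator_def)
    then show ?thesis using i U(3)[of x "p i"] by simp
  qed
  with P show thesis by (intro that)
qed

section \<open>Summability and diagonal subsequences\<close>

lemma borel_measurable_cnj [measurable (raw)]:
  "f \<in> borel_measurable M \<Longrightarrow> (\<lambda>x. cnj (f x)) \<in> borel_measurable M"
  by (rule measurable_compose[of f M borel cnj borel])
    (auto intro!: borel_measurable_continuous_onI continuous_intros)

text \<open>
  Monotone convergence: the integral of the sum is the sum of the integrals, hence the sum is
  finite almost everywhere.  The lemma upgrades fast \<open>L\<^sup>1\<close> convergence to pointwise convergence.
\<close>

lemma AE_summable_of_summable_integral:
  fixes f :: "nat \<Rightarrow> 'a \<Rightarrow> real"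
  assumes f: "\<And>k. integrable M (f k)" "\<And>k x. 0 \<le> f k x"
    and sum: "summable (\<lambda>k. LINT x|M. f k x)"
  shows "AE x in M. summable (\<lambda>k. f k x)"
proof -
  have "(\<integral>\<^sup>+x. (\<Sum>k. ennreal (f k x)) \<partial>M) = (\<Sum>k. \<integral>\<^sup>+x. ennreal (f k x) \<partial>M)"
    using f by (intro nn_integral_suminf) auto
  also have "\<dots> = (\<Sum>k. ennreal (LINT x|M. f k x))"
    using f by (intro suminf_cong nn_integral_eq_integral) auto
  also have "\<dots> = ennreal (\<Sum>k. LINT x|M. f k x)"
    using f sum by (intro suminf_ennreal2) (auto intro: Bochner_Integration.integral_nonneg)
  finally have "(\<integral>\<^sup>+x. (\<Sum>k. ennreal (f k x)) \<partial>M) \<noteq> \<infinity>" by simp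
  then have "AE x in M. (\<Sum>k. ennreal (f k x)) \<noteq> \<infinity>"
    using f by (intro nn_integral_PInf_AE) auto
  then show ?thesis
    by eventually_elim (use f(2) in \<open>auto intro: summable_suminf_not_top\<close>)
qed

text \<open>
  Each of the null sequences \<open>u k\<close> is eventually small, so at stage \<open>j\<close> the finitely many
  requirements for \<open>k \<le> j\<close> can be met at once.
\<close>

lemma diagonal_subsequence_rate:
  fixes u :: "nat \<Rightarrow> nat \<Rightarrow> real"
  assumes "\<And>k. u k \<longlonglongrightarrow> 0"
  obtains r where "strict_mono r" "\<And>k j. k \<le> j \<Longrightarrow> u k (r j) \<le> (1/2) ^ j"
proof -
  have "\<exists>r. \<forall>j. (\<forall>k\<le>j. u k (r j) \<le> (1/2) ^ j) \<and> r j < r (Suc j)"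
  proof (rule dependent_nat_choice[of "\<lambda>j n. \<forall>k\<le>j. u k n \<le> (1/2) ^ j" "\<lambda>_ n n'. n < n'"])
    have good: "\<forall>\<^sub>F n in sequentially. \<forall>k\<le>j. u k n \<le> (1/2) ^ j" for j
    proof -
      have "\<forall>\<^sub>F n in sequentially. u k n \<le> (1/2) ^ j" for k
        using order_tendstoD(2)[OF assms, of "(1/2) ^ j" k] by (auto elim: eventually_mono)
      then have "\<forall>\<^sub>F n in sequentially. \<forall>k\<in>{..j}. u k n \<le> (1/2) ^ j"
        by (intro eventually_ball_finite) auto
      then show ?thesis by (auto elim: eventually_mono)
    qed
    show "\<exists>n. \<forall>k\<le>0. u k n \<le> (1/2) ^ 0"
      using eventually_happens[OF good[of 0]] by auto
    fix n j assume "\<forall>k\<le>j. u k n \<le> (1/2) ^ j"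
    show "\<exists>n'. (\<forall>k\<le>Suc j. u k n' \<le> (1/2) ^ Suc j) \<and> n < n'"
      using eventually_happens[OF eventually_conj[OF good[of "Suc j"] eventually_gt_at_top[of n]]]
      by auto
  qed
  then show thesis using that strict_mono_Suc_iff by metis
qed

section \<open>Averages along orbits\<close>

locale ergodic_folner_system =
  fixes \<mu> :: "'g::{topological_ab_group_add,t2_space} measure"
    and act :: "'g \<Rightarrow> 'x::topological_space \<Rightarrow> 'x"
    and m :: "'x measure"
    and A :: "nat \<Rightarrow> 'g set"
  assumes sigma_compact: "sigma_compact_space TYPE('g)"
    and haar: "haar_measure \<mu>"
    and system: "topological_dynamical_system act"
    and metrizable: "metrizable_space (euclidean :: 'x topology)"
    and prob: "prob_space m"
    and invariant: "invariant_measure act m"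
    and ergodic: "ergodic_measure act m"
    and folner: "folner_sequence \<mu> A"
begin

sublocale prob_space m by (rule prob)

lemma sets_haar [measurable_cong, simp]: "sets \<mu> = sets borel"
  using haar by (simp add: haar_measure_def)

lemma space_haar [simp]: "space \<mu> = UNIV"
  using sets_eq_imp_space_eq[OF sets_haar] by simp

lemma sets_m [measurable_cong, simp]: "sets m = sets borel"
  using invariant unfolding invariant_measure_def by blast

lemma space_m [simp]: "space m = UNIV"
  using sets_eq_imp_space_eq[OF sets_m] by simp

lemma haar_translate: "S \<in> sets borel \<Longrightarrow> emeasure \<mu> ((+) t ` S) = emeasure \<mu> S"
  using haar by (simp add: haar_measure_def)

lemma haar_finite_compact: "compact K \<Longrightarrow> emeasure \<mu> K < \<infinity>"
  using haar by (simp add: haar_measure_def)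

sublocale haar: sigma_finite_measure \<mu>
proof
  obtain K :: "nat \<Rightarrow> 'g set" where K: "\<And>n. compact (K n)" "(\<Union>n. K n) = UNIV"
    using sigma_compact unfolding sigma_compact_space_def by blast
  have "emeasure \<mu> (K n) \<noteq> \<infinity>" for n
    using haar_finite_compact[OF K(1)[of n]] by simp
  moreover have "range K \<subseteq> sets \<mu>"
    using K(1) by (auto intro!: borel_closed compact_imp_closed)
  ultimately show "\<exists>C. countable C \<and> C \<subseteq> sets \<mu> \<and> \<Union>C = space \<mu> \<and> (\<forall>a\<in>C. emeasure \<mu> a \<noteq> \<infinity>)"
    using K(2) by (intro exI[of _ "range K"]) auto
qed

sublocale pair_sigma_finite \<mu> m ..

lemma measure_m_UNIV [simp]: "measure m UNIV = 1"
  using prob_space by simp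

lemma act_0 [simp]: "act 0 x = x"
  and act_add: "act (s + t) x = act s (act t x)"
  and compact_phase_space: "compact (UNIV :: 'x set)"
  and continuous_act: "continuous_on UNIV (\<lambda>(t, x). act t x)"
  using system unfolding topological_dynamical_system_def by auto

text \<open>
  All applications of Fubini's theorem below rest on this joint measurability.
\<close>

lemma measurable_act_pair [measurable]: "(\<lambda>(t, x). act t x) \<in> \<mu> \<Otimes>\<^sub>M m \<rightarrow>\<^sub>M m"
proof -
  obtain B :: "'x set set" where "countable B" "topological_basis B"
    using compact_metrizable_countable_basis[OF compact_phase_space metrizable] .
  then have "(\<lambda>(t, x). act t x) \<in> borel \<Otimes>\<^sub>M borel \<rightarrow>\<^sub>M borel"
    by (rule continuous_on_UNIV_measurable_pair[OF _ _ continuous_act])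
  then show ?thesis
    by (subst measurable_cong_sets[OF sets_pair_measure_cong[OF sets_haar sets_m] sets_m])
qed

lemma measurable_act [measurable (raw)]:
  assumes "f \<in> M \<rightarrow>\<^sub>M \<mu>" "g \<in> M \<rightarrow>\<^sub>M m" shows "(\<lambda>z. act (f z) (g z)) \<in> M \<rightarrow>\<^sub>M m"
proof -
  have "(\<lambda>z. (f z, g z)) \<in> M \<rightarrow>\<^sub>M \<mu> \<Otimes>\<^sub>M m" using assms by measurable
  from measurable_compose[OF this measurable_act_pair] show ?thesis by simp
qed

lemma distr_act: "distr m m (act t) = m"
proof -
  have "distr m m (act t) = distr m borel (act t)" by (rule distr_cong) auto
  then show ?thesis using invariant unfolding invariant_measure_def by simp
qed

lemma integral_act:
  fixes h :: "'x \<Rightarrow> 'b::{banach, second_countable_topology}"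
  assumes [measurable]: "h \<in> borel_measurable m"
  shows "(LINT x|m. h (act t x)) = (LINT x|m. h x)"
  using integral_distr[of "act t" m m h] by (simp add: distr_act)

lemma AE_act:
  assumes "AE x in m. P x" shows "AE x in m. P (act t x)"
proof (rule AE_distrD[where f = "act t" and M' = m and P = P])
  show "act t \<in> m \<rightarrow>\<^sub>M m" by measurable
  show "AE x in distr m m (act t). P x" unfolding distr_act by (rule assms)
qed

lemma
  shows open_folner: "open (A n)"
    and emeasure_folner: "emeasure \<mu> (A n) < \<infinity>"
    and measure_folner_pos: "measure \<mu> (A n) > 0"
    and folner_tendsto: "(\<lambda>n. measure \<mu> (sym_diff (A n) ((+) t ` A n)) / measure \<mu> (A n)) \<longlonglongrightarrow> 0"
proof -
  have "emeasure \<mu> (A n) \<le> emeasure \<mu> (closure (A n))"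
    by (intro emeasure_mono closure_subset) auto
  also have "\<dots> < \<infinity>"
    using folner by (intro haar_finite_compact) (simp add: folner_sequence_def)
  finally show "emeasure \<mu> (A n) < \<infinity>" .
qed (use folner in \<open>auto simp: folner_sequence_def\<close>)

lemma sets_folner [simp]: "A n \<in> sets borel"
  by (intro borel_open open_folner)

lemma sets_folner' [measurable]: "A n \<in> sets \<mu>"
  by simp

lemma integrable_folner: "integrable \<mu> (\<lambda>t. indicator (A n) t * (K::real))"
  using emeasure_folner by (intro integrable_mult_left integrable_real_indicator) auto

lemma integrable_bounded:
  fixes h :: "'x \<Rightarrow> 'b::{banach, second_countable_topology}"
  assumes "h \<in> borel_measurable m" "\<And>x. norm (h x) \<le> K"
  shows "integrable m h"
  using assms by (intro integrable_const_bound[of _ K]) auto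

lemma set_integrable_bounded:
  fixes g :: "'g \<Rightarrow> complex"
  assumes "g \<in> borel_measurable \<mu>" "\<And>t. cmod (g t) \<le> K"
  shows "set_integrable \<mu> (A n) g"
  unfolding set_integrable_def
  using assms emeasure_folner
  by (intro integrableI_bounded_set_indicator[where B = K]) auto

lemma set_average_le:
  fixes g :: "'g \<Rightarrow> complex"
  assumes g: "g \<in> borel_measurable \<mu>" "\<And>t. cmod (g t) \<le> K"
  shows "cmod (set_average \<mu> (A n) g) \<le> K"
proof -
  have "cmod (LINT t:A n|\<mu>. g t) \<le> (LINT t|\<mu>. indicator (A n) t * cmod (g t))"
    unfolding set_lebesgue_integral_def
    by (rule order_trans[OF integral_norm_bound]) simp
  also have "\<dots> \<le> (LINT t|\<mu>. indicator (A n) t * K)"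
    using set_integrable_norm[OF set_integrable_bounded[OF g, of n]] integrable_folner
    by (intro integral_mono) (auto simp: set_integrable_def g(2) mult_left_mono)
  also have "\<dots> = K * measure \<mu> (A n)" by simp
  finally show ?thesis
    using measure_folner_pos[of n] by (simp add: set_average_def field_simps)
qed

lemma set_average_diff:
  assumes "set_integrable \<mu> (A n) f" "set_integrable \<mu> (A n) g"
  shows "set_average \<mu> (A n) (\<lambda>t. f t - g t) = set_average \<mu> (A n) f - set_average \<mu> (A n) g"
  unfolding set_average_def set_integral_diff(2)[OF assms] by (rule scaleR_diff_right)

lemma set_average_cmult:
  "set_average \<mu> S (\<lambda>t. c * g t) = c * set_average \<mu> S g"
  unfolding set_average_def by simp

lemma set_average_sum:
  assumes "\<And>i. i \<in> I \<Longrightarrow> set_integrable \<mu> S (f i)"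
  shows "set_average \<mu> S (\<lambda>t. \<Sum>i\<in>I. f i t) = (\<Sum>i\<in>I. set_average \<mu> S (f i))"
proof -
  have "(LINT t:S|\<mu>. \<Sum>i\<in>I. f i t) = (\<Sum>i\<in>I. LINT t:S|\<mu>. f i t)"
    using assms unfolding set_lebesgue_integral_def set_integrable_def scaleR_sum_right
    by (rule Bochner_Integration.integral_sum)
  then show ?thesis unfolding set_average_def by (simp add: scaleR_sum_right)
qed

definition orbit_average :: "nat \<Rightarrow> ('x \<Rightarrow> complex) \<Rightarrow> 'x \<Rightarrow> complex" where
  "orbit_average n h x = set_average \<mu> (A n) (\<lambda>t. h (act t x))"

lemma measurable_orbit_average [measurable]:
  assumes [measurable]: "h \<in> borel_measurable m"
  shows "orbit_average n h \<in> borel_measurable m"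
  unfolding orbit_average_def set_average_def set_lebesgue_integral_def by measurable

lemma orbit_average_le:
  assumes h [measurable]: "h \<in> borel_measurable m" and K: "\<And>x. cmod (h x) \<le> K"
  shows "cmod (orbit_average n h x) \<le> K"
  unfolding orbit_average_def by (rule set_average_le) (use K in auto)

text \<open>
  Averaging is an \<open>L\<^sup>1\<close> contraction: interchange the two integrals and use that \<open>m\<close> is
  invariant, so that \<open>\<bar>h(t.x)\<bar>\<close> has the same integral over \<open>x\<close> for every \<open>t\<close>.
\<close>

lemma integral_orbit_average_le:
  assumes h [measurable]: "h \<in> borel_measurable m" and K: "\<And>x. cmod (h x) \<le> K"
  shows "(LINT x|m. cmod (orbit_average n h x)) \<le> (LINT x|m. cmod (h x))"
proof -
  let ?a = "measure \<mu> (A n)"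
  let ?k = "\<lambda>(t, x). indicator (A n) t * cmod (h (act t x))"
  have K0: "0 \<le> K" using K norm_ge_zero order_trans by blast
  have pair: "integrable (\<mu> \<Otimes>\<^sub>M m) ?k"
  proof (rule Bochner_Integration.integrable_bound)
    show "integrable (\<mu> \<Otimes>\<^sub>M m) (\<lambda>z. K * indicator (A n \<times> UNIV) z)"
      using emeasure_folner[of n] emeasure_space_1
        sigma_finite_measure.emeasure_pair_measure_Times[OF prob_space_imp_sigma_finite[OF prob], of "A n" \<mu> UNIV]
      by (intro integrable_mult_right integrable_real_indicator) (auto intro!: pair_measureI)
    show "?k \<in> borel_measurable (\<mu> \<Otimes>\<^sub>M m)" by measurable
    show "AE z in \<mu> \<Otimes>\<^sub>M m. norm (?k z) \<le> norm (K * indicator (A n \<times> UNIV) z)"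
      using K K0 by (auto simp: indicator_def)
  qed
  have orbit: "cmod (orbit_average n h x) \<le> (LINT t|\<mu>. ?k (t, x)) / ?a" for x
  proof -
    have "cmod (LINT t:A n|\<mu>. h (act t x)) \<le> (LINT t|\<mu>. ?k (t, x))"
      unfolding set_lebesgue_integral_def
      by (rule order_trans[OF integral_norm_bound]) simp
    then show ?thesis
      using measure_folner_pos[of n] unfolding orbit_average_def set_average_def
      by (simp add: field_simps)
  qed
  have "(LINT x|m. cmod (orbit_average n h x)) \<le> (LINT x|m. (LINT t|\<mu>. ?k (t, x)) / ?a)"
  proof (rule integral_mono)
    show "integrable m (\<lambda>x. cmod (orbit_average n h x))"
      using orbit_average_le[OF h K] by (intro integrable_bounded[of _ K]) auto
    show "integrable m (\<lambda>x. (LINT t|\<mu>. ?k (t, x)) / ?a)"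
      using integrable_snd[of "\<lambda>t x. ?k (t, x)"] pair by (intro integrable_divide) simp
  qed (use orbit in auto)
  also have "\<dots> = (LINT x|m. (LINT t|\<mu>. ?k (t, x))) / ?a" by simp
  also have "(LINT x|m. (LINT t|\<mu>. ?k (t, x))) = (LINT t|\<mu>. (LINT x|m. ?k (t, x)))"
    using Fubini_integral[of "\<lambda>t x. ?k (t, x)"] pair by simp
  also have "\<dots> = (LINT t|\<mu>. indicator (A n) t * (LINT x|m. cmod (h x)))"
    using integral_act[of "\<lambda>x. cmod (h x)"] by simp
  also have "\<dots> / ?a = (LINT x|m. cmod (h x))"
    using measure_folner_pos[of n] by simp
  finally show ?thesis .
qed

lemma distr_translate: "distr \<mu> \<mu> ((+) s) = \<mu>"
proof (rule measure_eqI)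
  fix S assume "S \<in> sets (distr \<mu> \<mu> ((+) s))"
  then have S: "S \<in> sets borel" by simp
  have "continuous_on UNIV ((+) s)" by (intro continuous_intros)
  then have meas: "(+) s \<in> \<mu> \<rightarrow>\<^sub>M \<mu>"
    using borel_measurable_continuous_onI by (simp cong: measurable_cong_sets)
  have "(+) s -` S = (+) (- s) ` S"
    using image_eqI[of _ "(+) (- s)" "s + _" S] by (auto simp: add.assoc[symmetric])
  then show "emeasure (distr \<mu> \<mu> ((+) s)) S = emeasure \<mu> S"
    using S meas haar_translate[of S "- s"] by (simp add: emeasure_distr)
qed simp

text \<open>
  Invariance of Haar measure turns the average of the translated function over \<open>A n\<close> into the average
  of \<open>h\<close> over \<open>s + A n\<close>, and the two averages differ only by contributions from the
  symmetric difference of \<open>A n\<close> and \<open>s + A n\<close>.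
\<close>

lemma orbit_average_shift:
  assumes h [measurable]: "h \<in> borel_measurable m" and K: "\<And>x. cmod (h x) \<le> K"
  shows "cmod (orbit_average n h x - orbit_average n (\<lambda>y. h (act s y)) x)
    \<le> K * (measure \<mu> (sym_diff (A n) ((+) s ` A n)) / measure \<mu> (A n))"
proof -
  let ?S = "(+) s ` A n" and ?g = "\<lambda>t. h (act t x)"
  have cont: "continuous_on UNIV ((+) r)" for r :: 'g by (intro continuous_intros)
  have meas [measurable]: "(+) s \<in> \<mu> \<rightarrow>\<^sub>M \<mu>"
    using borel_measurable_continuous_onI[OF cont] by (simp cong: measurable_cong_sets)
  have S_eq: "?S = (+) (- s) -` A n"
    using image_eqI[of _ "(+) s" "- s + _" "A n"] by (auto simp: add.assoc[symmetric])
  have S [measurable]: "?S \<in> sets \<mu>"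
    unfolding S_eq using open_vimage[OF open_folner cont] by simp
  have fin: "emeasure \<mu> ?S < \<infinity>"
    using haar_translate[of "A n" s] emeasure_folner[of n] open_folner[of n] by simp
  have fin': "emeasure \<mu> (sym_diff (A n) ?S) < \<infinity>"
  proof -
    have "emeasure \<mu> (sym_diff (A n) ?S) \<le> emeasure \<mu> (A n \<union> ?S)"
      using S by (intro emeasure_mono sets.Un) auto
    also have "\<dots> \<le> emeasure \<mu> (A n) + emeasure \<mu> ?S" by (rule emeasure_subadditive) (use S in auto)
    also have "\<dots> < \<infinity>" using fin emeasure_folner[of n] by (simp add: ennreal_add_less_top)
    finally show ?thesis .
  qed
  have iA: "integrable \<mu> (\<lambda>t. indicator (A n) t *\<^sub>R ?g t)"
    using K emeasure_folner by (intro integrableI_bounded_set_indicator[where B = K]) auto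
  have iS: "integrable \<mu> (\<lambda>t. indicator ?S t *\<^sub>R ?g t)"
    using K fin S by (intro integrableI_bounded_set_indicator[where B = K]) auto
  have "(LINT t:A n|\<mu>. h (act s (act t x))) = (LINT t|\<mu>. indicator ?S (s + t) *\<^sub>R ?g (s + t))"
    unfolding set_lebesgue_integral_def
    by (intro Bochner_Integration.integral_cong) (auto simp: act_add indicator_def image_iff)
  also have "\<dots> = (LINT t|\<mu>. indicator ?S t *\<^sub>R ?g t)"
    using integral_distr[OF meas, of "\<lambda>t. indicator ?S t *\<^sub>R ?g t"] by (simp add: distr_translate)
  finally have shift: "(LINT t:A n|\<mu>. h (act s (act t x))) = (LINT t|\<mu>. indicator ?S t *\<^sub>R ?g t)" .
  have "cmod ((LINT t:A n|\<mu>. ?g t) - (LINT t:A n|\<mu>. h (act s (act t x))))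
      = cmod (LINT t|\<mu>. indicator (A n) t *\<^sub>R ?g t - indicator ?S t *\<^sub>R ?g t)"
    unfolding shift using iA iS by (simp add: set_lebesgue_integral_def)
  also have "\<dots> \<le> (LINT t|\<mu>. cmod (indicator (A n) t *\<^sub>R ?g t - indicator ?S t *\<^sub>R ?g t))"
    by (rule integral_norm_bound)
  also have "\<dots> \<le> (LINT t|\<mu>. indicator (sym_diff (A n) ?S) t * K)"
  proof (rule integral_mono)
    show "integrable \<mu> (\<lambda>t. cmod (indicator (A n) t *\<^sub>R ?g t - indicator ?S t *\<^sub>R ?g t))"
      using iA iS by (intro integrable_norm Bochner_Integration.integrable_diff)
    show "integrable \<mu> (\<lambda>t. indicator (sym_diff (A n) ?S) t * K)"
      using fin' S by (intro integrable_mult_left integrable_real_indicator sets.Un sets.Diff) auto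
  qed (use K in \<open>auto simp: indicator_def\<close>)
  also have "\<dots> = K * measure \<mu> (sym_diff (A n) ?S)" by simp
  finally have "cmod ((LINT t:A n|\<mu>. ?g t) - (LINT t:A n|\<mu>. h (act s (act t x))))
      / measure \<mu> (A n) \<le> K * measure \<mu> (sym_diff (A n) ?S) / measure \<mu> (A n)"
    by (intro divide_right_mono) auto
  then show ?thesis
    unfolding orbit_average_def set_average_def scaleR_diff_right[symmetric] norm_scaleR
    by (simp add: divide_inverse mult.commute mult.left_commute)
qed

section \<open>The mean ergodic theorem\<close>

text \<open>
  The dyadic convex combinations of translates of \<open>h\<close>.  Midpoints are the only convex combinations
  that the parallelogram law needs, and generating the hull by them allows every
  property below to be proved by induction.
\<close>

inductive_set midpoint_hull :: "('x \<Rightarrow> complex) \<Rightarrow> ('x \<Rightarrow> complex) set"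
  for h :: "'x \<Rightarrow> complex"
  where
    translate: "(\<lambda>x. h (act t x)) \<in> midpoint_hull h"
  | midpoint: "c \<in> midpoint_hull h \<Longrightarrow> d \<in> midpoint_hull h \<Longrightarrow> (\<lambda>x. (c x + d x) / 2) \<in> midpoint_hull h"

lemma midpoint_hull_translate:
  "c \<in> midpoint_hull h \<Longrightarrow> (\<lambda>x. c (act t x)) \<in> midpoint_hull h"
proof (induction rule: midpoint_hull.induct)
  case (translate s)
  then show ?case
    using midpoint_hull.translate[of h "s + t"] by (simp add: act_add)
qed (rule midpoint_hull.midpoint)

context
  fixes h :: "'x \<Rightarrow> complex" and K :: real
  assumes h [measurable]: "h \<in> borel_measurable m" and K: "\<And>x. cmod (h x) \<le> K"
begin

lemma midpoint_hull_measurable: "c \<in> midpoint_hull h \<Longrightarrow> c \<in> borel_measurable m"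
proof (induction rule: midpoint_hull.induct)
  case (midpoint c d)
  note [measurable] = midpoint.IH
  show ?case by measurable
qed measurable

lemma midpoint_hull_bound: "c \<in> midpoint_hull h \<Longrightarrow> cmod (c x) \<le> K"
proof (induction rule: midpoint_hull.induct)
  case (midpoint c d)
  then show ?case
    using norm_triangle_ineq[of "c x" "d x"] by (simp add: norm_divide)
qed (rule K)

lemma midpoint_hull_integrable: "c \<in> midpoint_hull h \<Longrightarrow> integrable m c"
  using midpoint_hull_measurable midpoint_hull_bound integrable_bounded by blast

lemma midpoint_hull_integral: "c \<in> midpoint_hull h \<Longrightarrow> (LINT x|m. c x) = (LINT x|m. h x)"
  by (induction rule: midpoint_hull.induct)
    (simp_all add: integral_act midpoint_hull_integrable)

text \<open>
  Translates of \<open>h\<close> have asymptotically the same averages as \<open>h\<close> by the Foelner property, and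
  averages are additive.  The error bound is uniform in \<open>x\<close> so that it can be integrated.
\<close>

lemma orbit_average_midpoint_hull:
  assumes "c \<in> midpoint_hull h"
  shows "\<exists>\<delta>. \<delta> \<longlonglongrightarrow> 0 \<and> (\<forall>n x. cmod (orbit_average n h x - orbit_average n c x) \<le> \<delta> n)"
  using assms
proof (induction rule: midpoint_hull.induct)
  case (translate t)
  have "(\<lambda>n. K * (measure \<mu> (sym_diff (A n) ((+) t ` A n)) / measure \<mu> (A n))) \<longlonglongrightarrow> 0"
    using tendsto_mult_right_zero[OF folner_tendsto] .
  then show ?case using orbit_average_shift[OF h K] by blast
next
  case (midpoint c d)
  then obtain \<delta> \<epsilon> where \<delta>: "\<delta> \<longlonglongrightarrow> 0" "\<And>n x. cmod (orbit_average n h x - orbit_average n c x) \<le> \<delta> n"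
    and \<epsilon>: "\<epsilon> \<longlonglongrightarrow> 0" "\<And>n x. cmod (orbit_average n h x - orbit_average n d x) \<le> \<epsilon> n" by blast
  have "cmod (orbit_average n h x - orbit_average n (\<lambda>x. (c x + d x) / 2) x) \<le> (\<delta> n + \<epsilon> n) / 2" for n x
  proof -
    have int: "set_integrable \<mu> (A n) (\<lambda>t. e (act t x))" if "e \<in> midpoint_hull h" for e
      using midpoint_hull_measurable[OF that] midpoint_hull_bound[OF that]
      by (intro set_integrable_bounded) auto
    have "orbit_average n (\<lambda>x. (c x + d x) / 2) x = (orbit_average n c x + orbit_average n d x) / 2"
      using int[OF midpoint.hyps(1)] int[OF midpoint.hyps(2)] measure_folner_pos[of n]
      unfolding orbit_average_def set_average_def
      by (simp add: scaleR_conv_of_real field_simps)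
    then have "orbit_average n h x - orbit_average n (\<lambda>x. (c x + d x) / 2) x =
      ((orbit_average n h x - orbit_average n c x) + (orbit_average n h x - orbit_average n d x)) / 2"
      by (simp add: field_simps)
    then show ?thesis
      using norm_triangle_mono[OF \<delta>(2)[of n x] \<epsilon>(2)[of n x]] by (simp only: norm_divide) simp
  qed
  moreover have "(\<lambda>n. (\<delta> n + \<epsilon> n) / 2) \<longlonglongrightarrow> 0"
    using tendsto_divide[OF tendsto_add[OF \<delta>(1) \<epsilon>(1)] tendsto_const[of 2]] by simp
  ultimately show ?case by blast
qed

definition hull_energy :: "('x \<Rightarrow> complex) \<Rightarrow> real" where
  "hull_energy c = (LINT x|m. (cmod (c x))\<^sup>2)"

text \<open>
  The midpoint of \<open>c\<close> and \<open>d\<close> lies in the hull, so its energy is at least the infimum; the parallelogram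
  law then bounds the distance of two elements by how far they are from being minimal.
\<close>

lemma hull_energy_parallelogram:
  assumes c: "c \<in> midpoint_hull h" and d: "d \<in> midpoint_hull h"
  shows "(LINT x|m. (cmod (c x - d x))\<^sup>2)
    \<le> 2 * (hull_energy c - (INF c\<in>midpoint_hull h. hull_energy c))
      + 2 * (hull_energy d - (INF c\<in>midpoint_hull h. hull_energy c))"
proof -
  note [measurable] = midpoint_hull_measurable[OF c] midpoint_hull_measurable[OF d]
  have int: "integrable m (\<lambda>x. (cmod (e x))\<^sup>2)" if "e \<in> midpoint_hull h" for e
    using midpoint_hull_measurable[OF that] midpoint_hull_bound[OF that]
    by (intro integrable_bounded[of _ "K\<^sup>2"]) (auto intro: power_mono)
  have par: "(cmod (c x - d x))\<^sup>2 = 2 * (cmod (c x))\<^sup>2 + 2 * (cmod (d x))\<^sup>2 - 4 * (cmod ((c x + d x) / 2))\<^sup>2" for x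
    unfolding cmod_power2 by (simp add: power2_eq_square field_simps)
  have "(LINT x|m. (cmod (c x - d x))\<^sup>2)
      = 2 * hull_energy c + 2 * hull_energy d - 4 * hull_energy (\<lambda>x. (c x + d x) / 2)"
    unfolding par hull_energy_def
    using int[OF c] int[OF d] int[OF midpoint_hull.midpoint[OF c d]] by simp
  moreover have "(INF c\<in>midpoint_hull h. hull_energy c) \<le> hull_energy (\<lambda>x. (c x + d x) / 2)"
    by (intro cINF_lower midpoint_hull.midpoint c d bdd_belowI2[where m = 0])
      (simp add: hull_energy_def)
  ultimately show ?thesis by simp
qed

text \<open>
  A minimising sequence \<open>c k\<close> is Cauchy by the parallelogram estimate and converges almost
  everywhere if its energies approach the infimum at rate \<open>4\<^sup>-\<^sup>k\<close>, since consecutive \<open>L\<^sup>1\<close>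
  distances are then of order \<open>2\<^sup>-\<^sup>k\<close>.  Translating \<open>c k\<close> by \<open>t\<close> gives another
  element of the hull with the same energy, so the estimate also shows that the limit is
  invariant.  By ergodicity it is constant, and the constant is the integral of \<open>h\<close>, which all elements
  of the hull share.
\<close>

lemma midpoint_hull_approximates_mean:
  assumes "\<epsilon> > 0"
  obtains c where "c \<in> midpoint_hull h" "(LINT x|m. cmod (c x - (LINT y|m. h y))) < \<epsilon>"
proof -
  let ?D = "INF c\<in>midpoint_hull h. hull_energy c"
  have "\<exists>c\<in>midpoint_hull h. hull_energy c < ?D + (1/4) ^ k" for k :: nat
    using midpoint_hull.translate[of h 0]
    by (subst cINF_less_iff[symmetric]) (auto intro!: bdd_belowI2[where m = 0] simp: hull_energy_def)
  then obtain c where c: "\<And>k. c k \<in> midpoint_hull h" "\<And>k :: nat. hull_energy (c k) < ?D + (1/4) ^ k"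
    by metis
  note meas [measurable] = midpoint_hull_measurable[OF c(1)]
  have bound: "cmod (c k x) \<le> K" for k x using midpoint_hull_bound[OF c(1)] .
  have K0: "0 \<le> K" using K norm_ge_zero order_trans by blast
  have bound_diff: "cmod (c k x - c l y) \<le> 2 * K" for k l x y
    using norm_triangle_ineq4[of "c k x" "c l y"] bound[of k x] bound[of l y] by linarith
  have bound_diff2: "(cmod (c k x - c l y))\<^sup>2 \<le> (2 * K)\<^sup>2" for k l x y
    by (intro power_mono bound_diff) simp
  have L1: "(LINT x|m. cmod (c (Suc k) x - c k x)) \<le> 2 * (1/2) ^ k" for k
  proof -
    let ?u = "\<lambda>x. cmod (c (Suc k) x - c k x)"
    have int: "integrable m ?u"
      by (rule integrable_bounded[of _ "2 * K"]) (auto intro: bound_diff)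
    have int2: "integrable m (\<lambda>x. (?u x)\<^sup>2)"
      by (rule integrable_bounded[of _ "(2 * K)\<^sup>2"]) (use bound_diff2 in auto)
    \<comment> \<open>The variance of \<open>?u\<close> is nonnegative.\<close>
    have "(LINT x|m. ?u x)\<^sup>2 \<le> (LINT x|m. (?u x)\<^sup>2)"
      using variance_positive[of ?u] variance_eq[OF int int2] by simp
    also have "\<dots> \<le> 2 * (1/4) ^ Suc k + 2 * (1/4) ^ k"
    proof -
      have "a \<le> 2 * s + 2 * t" if "a \<le> 2 * (p - D) + 2 * (q - D)" "p < D + s" "q < D + t"
        for a p q s t D :: real using that by simp
      from this[OF hull_energy_parallelogram[OF c(1) c(1)] c(2) c(2)] show ?thesis .
    qed
    also have "\<dots> \<le> 4 * (1/4) ^ k" by simp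
    also have "\<dots> = (2 * (1/2) ^ k)\<^sup>2"
      by (simp add: power_divide) (simp add: power2_eq_square flip: power_mult_distrib)
    finally show ?thesis by (rule power2_le_imp_le) simp
  qed
  have "AE x in m. summable (\<lambda>k. cmod (c (Suc k) x - c k x))"
  proof (rule AE_summable_of_summable_integral)
    show "integrable m (\<lambda>x. cmod (c (Suc k) x - c k x))" for k
      by (rule integrable_bounded[of _ "2 * K"]) (auto intro: bound_diff)
    show "summable (\<lambda>k. LINT x|m. cmod (c (Suc k) x - c k x))"
    proof (rule summable_comparison_test')
      show "summable (\<lambda>k. 2 * (1/2) ^ k :: real)" by (intro summable_mult summable_geometric) simp
      show "norm (LINT x|m. cmod (c (Suc k) x - c k x)) \<le> 2 * (1/2) ^ k" if "0 \<le> k" for k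
        using L1[of k] by simp
    qed
  qed simp
  then have conv: "AE x in m. (\<lambda>k. c k x) \<longlonglongrightarrow> lim (\<lambda>k. c k x)"
  proof eventually_elim
    fix x assume "summable (\<lambda>k. cmod (c (Suc k) x - c k x))"
    then have "summable (\<lambda>k. c (Suc k) x - c k x)" by (rule summable_norm_cancel)
    then have "convergent (\<lambda>n. c 0 x + (\<Sum>k<n. c (Suc k) x - c k x))"
      by (intro convergent_add convergent_const) (simp add: summable_iff_convergent)
    then show "(\<lambda>k. c k x) \<longlonglongrightarrow> lim (\<lambda>k. c k x)"
      by (simp add: sum_lessThan_telescope[of "\<lambda>k. c k x"] convergent_LIMSEQ_iff)
  qed
  define c' where "c' x = lim (\<lambda>k. c k x)" for x
  have c'_meas [measurable]: "c' \<in> borel_measurable m"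
    unfolding c'_def by (intro borel_measurable_lim_metric) auto
  have conv: "AE x in m. (\<lambda>k. c k x) \<longlonglongrightarrow> c' x"
    using conv by (simp add: c'_def)
  have "AE x in m. c' (act t x) = c' x" for t
  proof -
    \<comment> \<open>Dominated convergence identifies the limit of these integrals; the parallelogram estimate makes it zero.\<close>
    have "(\<lambda>k. LINT x|m. (cmod (c k (act t x) - c k x))\<^sup>2) \<longlonglongrightarrow> (LINT x|m. (cmod (c' (act t x) - c' x))\<^sup>2)"
    proof (rule integral_dominated_convergence[where w = "\<lambda>_. (2 * K)\<^sup>2"])
      show "AE x in m. (\<lambda>k. (cmod (c k (act t x) - c k x))\<^sup>2) \<longlonglongrightarrow> (cmod (c' (act t x) - c' x))\<^sup>2"
        using conv AE_act[OF conv, of t]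
        by eventually_elim (intro tendsto_intros)
    qed (use bound_diff2 in auto)
    moreover have "(\<lambda>k. LINT x|m. (cmod (c k (act t x) - c k x))\<^sup>2) \<longlonglongrightarrow> 0"
    proof (rule tendsto_sandwich[of "\<lambda>_. 0" _ _ "\<lambda>k. 4 * (1/4) ^ k"])
      have "hull_energy (\<lambda>x. c k (act t x)) = hull_energy (c k)" for k
        unfolding hull_energy_def using integral_act[of "\<lambda>x. (cmod (c k x))\<^sup>2" t] by simp
      then have "(LINT x|m. (cmod (c k (act t x) - c k x))\<^sup>2) \<le> 4 * (1/4) ^ k" for k
        using hull_energy_parallelogram[OF midpoint_hull_translate[OF c(1)] c(1), of k t k] c(2)[of k]
        by simp
      then show "\<forall>\<^sub>F k in sequentially. (LINT x|m. (cmod (c k (act t x) - c k x))\<^sup>2) \<le> 4 * (1/4) ^ k"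
        by simp
      show "(\<lambda>k. 4 * (1/4) ^ k :: real) \<longlonglongrightarrow> 0"
        by (intro tendsto_mult_right_zero LIMSEQ_power_zero) simp
    qed auto
    ultimately have eq: "(LINT x|m. (cmod (c' (act t x) - c' x))\<^sup>2) = 0"
      using LIMSEQ_unique by blast
    have bound': "AE x in m. cmod (c' x) \<le> K"
      using conv by eventually_elim (rule tendsto_upperbound[OF tendsto_norm], use bound in auto)
    have "AE x in m. (cmod (c' (act t x) - c' x))\<^sup>2 = 0"
    proof (subst integral_nonneg_eq_0_iff_AE[symmetric])
      show "integrable m (\<lambda>x. (cmod (c' (act t x) - c' x))\<^sup>2)"
      proof (rule integrable_const_bound[of _ "(2 * K)\<^sup>2"])
        show "AE x in m. norm ((cmod (c' (act t x) - c' x))\<^sup>2) \<le> (2 * K)\<^sup>2"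
          using bound' AE_act[OF bound', of t]
        proof eventually_elim
          case (elim x)
          then have "cmod (c' (act t x) - c' x) \<le> 2 * K"
            using norm_triangle_ineq4[of "c' (act t x)" "c' x"] by linarith
          then show ?case using power_mono[of _ _ 2] by fastforce
        qed
      qed measurable
    qed (use eq in auto)
    then show ?thesis by eventually_elim simp
  qed
  then obtain z where z: "AE x in m. c' x = z"
    using ergodic c'_meas unfolding ergodic_measure_def by blast
  have "(\<lambda>k. LINT x|m. c k x) \<longlonglongrightarrow> (LINT x|m. c' x)"
    by (rule integral_dominated_convergence[where w = "\<lambda>_. K"]) (use conv bound in auto)
  moreover have "(LINT x|m. c' x) = z"
    using integral_cong_AE[of c' m "\<lambda>_. z"] z by (simp add: prob_space)
  ultimately have z_eq: "z = (LINT x|m. h x)"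
    using midpoint_hull_integral[OF c(1)] LIMSEQ_const_iff by (metis (no_types, lifting) ext)
  have "(\<lambda>k. LINT x|m. cmod (c k x - z)) \<longlonglongrightarrow> (LINT x|m. 0)"
  proof (rule integral_dominated_convergence[where w = "\<lambda>_. K + cmod z"])
    show "AE x in m. (\<lambda>k. cmod (c k x - z)) \<longlonglongrightarrow> 0"
      using conv z
    proof eventually_elim
      case (elim x)
      then show ?case using tendsto_norm[OF tendsto_diff[OF elim(1) tendsto_const[of z]]] by simp
    qed
    show "AE x in m. norm (cmod (c k x - z)) \<le> K + cmod z" for k
    proof (rule AE_I2)
      fix x show "norm (cmod (c k x - z)) \<le> K + cmod z"
        using norm_triangle_ineq4[of "c k x" z] bound[of k x] by simp
    qed
  qed auto
  then have "\<forall>\<^sub>F k in sequentially. (LINT x|m. cmod (c k x - z)) < \<epsilon>"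
    using order_tendstoD(2)[of _ 0 sequentially \<epsilon>] assms by simp
  then obtain k where "(LINT x|m. cmod (c k x - z)) < \<epsilon>"
    using eventually_happens[of _ sequentially] by auto
  then show thesis
    using that[OF c(1)[of k]] unfolding z_eq by blast
qed

text \<open>
  Split \<open>h\<close> into an element \<open>c\<close> of the hull that is \<open>L\<^sup>1\<close>-close to the mean, whose averages stay
  close to it by the contraction property, and the difference \<open>h - c\<close>, whose averages vanish asymptotically.
\<close>

theorem mean_ergodic_L1:
  "(\<lambda>n. LINT x|m. cmod (orbit_average n h x - (LINT y|m. h y))) \<longlonglongrightarrow> 0"
proof (rule LIMSEQ_I)
  fix \<epsilon> :: real assume "\<epsilon> > 0"
  let ?z = "LINT y|m. h y"
  obtain c where c: "c \<in> midpoint_hull h" "(LINT x|m. cmod (c x - ?z)) < \<epsilon> / 2"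
    using midpoint_hull_approximates_mean[of "\<epsilon> / 2"] \<open>\<epsilon> > 0\<close> by auto
  obtain \<delta> where \<delta>: "\<delta> \<longlonglongrightarrow> 0" "\<And>n x. cmod (orbit_average n h x - orbit_average n c x) \<le> \<delta> n"
    using orbit_average_midpoint_hull[OF c(1)] by blast
  note [measurable] = midpoint_hull_measurable[OF c(1)]
  have bound: "cmod (c x - ?z) \<le> K + cmod ?z" for x
    using norm_triangle_ineq4[of "c x" ?z] midpoint_hull_bound[OF c(1), of x] by linarith
  have le: "(LINT x|m. cmod (orbit_average n h x - ?z)) \<le> \<delta> n + (LINT x|m. cmod (c x - ?z))" for n
  proof -
    have avg: "orbit_average n (\<lambda>x. c x - ?z) x = orbit_average n c x - ?z" for x
    proof -
      have "set_average \<mu> (A n) (\<lambda>t. ?z) = ?z"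
        using measure_folner_pos[of n] emeasure_folner[of n]
        by (simp add: set_average_def set_lebesgue_integral_def scaleR_conv_of_real)
      then show ?thesis
        unfolding orbit_average_def
        using midpoint_hull_bound[OF c(1)] set_integrable_bounded[of "\<lambda>t. c (act t x)" K n]
          set_integrable_bounded[of "\<lambda>t. ?z" "cmod ?z" n]
        by (subst set_average_diff) auto
    qed
    have int: "integrable m (\<lambda>x. cmod (orbit_average n c x - ?z))"
      unfolding avg[symmetric] using orbit_average_le[of "\<lambda>x. c x - ?z" "K + cmod ?z" n] bound
      by (intro integrable_bounded[of _ "K + cmod ?z"]) auto
    have "(LINT x|m. cmod (orbit_average n h x - ?z)) \<le> (LINT x|m. \<delta> n + cmod (orbit_average n c x - ?z))"
    proof (rule integral_mono)
      have "cmod (orbit_average n h x - ?z) \<le> K + cmod ?z" for x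
        using norm_triangle_ineq4[of "orbit_average n h x" ?z] orbit_average_le[OF h K, of n x]
        by linarith
      then show "integrable m (\<lambda>x. cmod (orbit_average n h x - ?z))"
        by (intro integrable_bounded[of _ "K + cmod ?z"]) auto
      show "integrable m (\<lambda>x. \<delta> n + cmod (orbit_average n c x - ?z))"
        using int by simp
      show "cmod (orbit_average n h x - ?z) \<le> \<delta> n + cmod (orbit_average n c x - ?z)" for x
        using norm_triangle_ineq[of "orbit_average n h x - orbit_average n c x" "orbit_average n c x - ?z"] \<delta>(2)[of n x]
        by simp
    qed
    also have "\<dots> = \<delta> n + (LINT x|m. cmod (orbit_average n (\<lambda>x. c x - ?z) x))"
      using int by (simp add: avg prob_space)
    also have "\<dots> \<le> \<delta> n + (LINT x|m. cmod (c x - ?z))"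
      using bound by (intro add_left_mono integral_orbit_average_le) auto
    finally show ?thesis .
  qed
  obtain N where N: "\<And>n. n \<ge> N \<Longrightarrow> \<delta> n < \<epsilon> / 2"
    using order_tendstoD(2)[OF \<delta>(1), of "\<epsilon> / 2"] \<open>\<epsilon> > 0\<close> by (auto simp: eventually_sequentially)
  show "\<exists>N. \<forall>n\<ge>N. norm ((LINT x|m. cmod (orbit_average n h x - ?z)) - 0) < \<epsilon>"
  proof (intro exI allI impI)
    fix n assume "N \<le> n"
    then show "norm ((LINT x|m. cmod (orbit_average n h x - ?z)) - 0) < \<epsilon>"
      using le[of n] N[of n] c(2) by simp
  qed
qed

end

text \<open>
  One subsequence serves countably many functions: the \<open>L\<^sup>1\<close> error of the \<open>k\<close>-th function is at most
  \<open>2\<^sup>-\<^sup>j\<close> at every stage \<open>j \<ge> k\<close>, hence summable.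
\<close>

theorem pointwise_ergodic_subsequence:
  assumes H: "countable H" and meas: "\<And>h. h \<in> H \<Longrightarrow> h \<in> borel_measurable m"
    and bound: "\<And>h x. h \<in> H \<Longrightarrow> cmod (h x) \<le> K"
  shows "\<exists>r. strict_mono r \<and>
    (\<forall>h\<in>H. AE x in m. (\<lambda>n. orbit_average (r n) h x) \<longlonglongrightarrow> (LINT y|m. h y))"
proof (cases "H = {}")
  case True
  then show ?thesis by (intro exI[of _ id]) (auto simp: strict_mono_def)
next
  case False
  define u where "u k n = (LINT x|m. cmod (orbit_average n (from_nat_into H k) x
    - (LINT y|m. from_nat_into H k y)))" for k n
  have "u k \<longlonglongrightarrow> 0" for k
    unfolding u_def using from_nat_into[OF False] meas bound by (intro mean_ergodic_L1) auto
  then obtain r where r: "strict_mono r" "\<And>k j. k \<le> j \<Longrightarrow> u k (r j) \<le> (1/2) ^ j"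
    using diagonal_subsequence_rate by blast
  have "AE x in m. (\<lambda>n. orbit_average (r n) h x) \<longlonglongrightarrow> (LINT y|m. h y)" if hH: "h \<in> H" for h
  proof -
    obtain k where k: "from_nat_into H k = h" using from_nat_into_surj[OF H hH] by blast
    let ?e = "\<lambda>j x. cmod (orbit_average (r j) h x - (LINT y|m. h y))"
    note [measurable] = meas[OF hH]
    have "AE x in m. summable (\<lambda>j. ?e j x)"
    proof (rule AE_summable_of_summable_integral)
      fix j
      have "?e j x \<le> K + cmod (LINT y|m. h y)" for x
        using norm_triangle_ineq4[of "orbit_average (r j) h x" "LINT y|m. h y"]
          orbit_average_le[OF meas[OF hH] bound[OF hH], of "r j" x]
        by linarith
      then show "integrable m (?e j)"
        by (intro integrable_bounded[of _ "K + cmod (LINT y|m. h y)"]) auto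
    next
      show "summable (\<lambda>j. LINT x|m. ?e j x)"
      proof (rule summable_comparison_test')
        show "summable (\<lambda>j. (1/2) ^ j :: real)" by (rule summable_geometric) simp
        show "norm (LINT x|m. ?e j x) \<le> (1/2) ^ j" if "k \<le> j" for j
          using r(2)[OF that] by (simp add: u_def k)
      qed
    qed simp
    then show ?thesis
    proof eventually_elim
      case (elim x)
      show ?case by (rule LIM_zero_cancel[OF tendsto_norm_zero_cancel[OF summable_LIMSEQ_zero[OF elim]]])
    qed
  qed
  with r(1) show ?thesis by blast
qed

section \<open>Eigenfunctions\<close>

text \<open>
  Modulus one is required at every point and not only almost everywhere.  This makes the functions
  bounded, and \<open>e x\<close> may be used as a unimodular constant at any given point \<open>x\<close>.
\<close>

definition unimodular_eigenfunction :: "('g \<Rightarrow> complex) \<Rightarrow> ('x \<Rightarrow> complex) \<Rightarrow> bool" where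
  "unimodular_eigenfunction \<xi> e \<longleftrightarrow> e \<in> borel_measurable m \<and> (\<forall>x. cmod (e x) = 1) \<and>
     (\<forall>t. AE x in m. e (act t x) = \<xi> t * e x)"

lemma unimodular_eigenfunctionD:
  assumes "unimodular_eigenfunction \<xi> e"
  shows "e \<in> borel_measurable m" "cmod (e x) = 1" "AE x in m. e (act t x) = \<xi> t * e x"
    "e x * cnj (e x) = 1"
  using assms unfolding unimodular_eigenfunction_def by (auto simp: complex_norm_square[symmetric])

lemma dual_groupD:
  assumes "\<xi> \<in> dual_group"
  shows "\<xi> \<in> borel_measurable \<mu>" "cmod (\<xi> t) = 1" "\<xi> t * cnj (\<xi> t) = 1"
proof -
  have "\<xi> \<in> borel_measurable borel"
    using assms by (intro borel_measurable_continuous_onI) (simp add: dual_group_def)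
  then show "\<xi> \<in> borel_measurable \<mu>" by (simp cong: measurable_cong_sets)
qed (use assms in \<open>auto simp: dual_group_def complex_norm_square[symmetric]\<close>)

text \<open>
  The modulus of an eigenfunction is invariant, hence almost everywhere equal to a nonzero constant, and the
  eigenfunction may be divided by its modulus.
\<close>

lemma unimodular_eigenfunction_exists:
  assumes \<xi>: "\<xi> \<in> point_spectrum act m"
  shows "\<exists>e. unimodular_eigenfunction \<xi> e"
proof -
  have \<xi>': "\<xi> \<in> dual_group" using \<xi> unfolding point_spectrum_def by blast
  obtain f where f: "eigenfunction act m \<xi> f" using \<xi> unfolding point_spectrum_def by blast
  then have [measurable]: "f \<in> borel_measurable m" and inv: "\<And>t. AE x in m. f (act t x) = \<xi> t * f x"
    and nonzero: "\<not> (AE x in m. f x = 0)"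
    unfolding eigenfunction_def eigenspace_def square_integrable_def by auto
  have "AE x in m. complex_of_real (cmod (f (act t x))) = complex_of_real (cmod (f x))" for t
    using inv[of t] by eventually_elim (simp add: norm_mult dual_groupD(2)[OF \<xi>'])
  moreover have "(\<lambda>x. complex_of_real (cmod (f x))) \<in> borel_measurable m" by measurable
  ultimately obtain c where "AE x in m. complex_of_real (cmod (f x)) = c"
    using ergodic unfolding ergodic_measure_def by meson
  then have r: "AE x in m. cmod (f x) = Re c"
    by eventually_elim auto
  have "Re c \<noteq> 0"
    using nonzero r by (metis (mono_tags, lifting) AE_mp AE_I2 norm_eq_zero)
  define e where "e x = (if f x = 0 then 1 else f x / complex_of_real (cmod (f x)))" for x
  have "e \<in> borel_measurable m" unfolding e_def by measurable
  moreover have "cmod (e x) = 1" for x by (simp add: e_def norm_divide)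
  moreover have "AE x in m. e (act t x) = \<xi> t * e x" for t
    using r AE_act[OF r, of t] inv[of t]
  proof eventually_elim
    case (elim x)
    then have "f x \<noteq> 0" "f (act t x) \<noteq> 0" using \<open>Re c \<noteq> 0\<close> by auto
    then show ?case using elim by (simp add: e_def)
  qed
  ultimately show ?thesis unfolding unimodular_eigenfunction_def by blast
qed

lemma unimodular_eigenfunction_scale:
  assumes "unimodular_eigenfunction \<xi> e" "cmod z = 1"
  shows "unimodular_eigenfunction \<xi> (\<lambda>x. z * e x)"
proof -
  note [measurable] = unimodular_eigenfunctionD(1)[OF assms(1)]
  have "AE x in m. z * e (act t x) = \<xi> t * (z * e x)" for t
    using unimodular_eigenfunctionD(3)[OF assms(1), of t] by eventually_elim simp
  then show ?thesis
    using assms(2) unimodular_eigenfunctionD(2)[OF assms(1)]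
    unfolding unimodular_eigenfunction_def by (auto simp: norm_mult)
qed

lemma eigenfunction_unimodular:
  assumes e: "unimodular_eigenfunction \<xi> e"
  shows "eigenfunction act m \<xi> e"
proof -
  have "\<not> (AE x in m. e x = 0)"
  proof
    assume "AE x in m. e x = 0"
    then have "AE x in m. False"
      by eventually_elim (metis unimodular_eigenfunctionD(2)[OF e] norm_zero zero_neq_one)
    then show False by simp
  qed
  then show ?thesis
    using unimodular_eigenfunctionD[OF e]
    unfolding eigenfunction_def eigenspace_def square_integrable_def by simp
qed

lemma eigenfunction_unique_eigenvalue:
  assumes "eigenfunction act m \<xi> f" "eigenfunction act m \<xi>' f"
  shows "\<xi> = \<xi>'"
proof (rule ext, rule ccontr)
  fix t assume ne: "\<xi> t \<noteq> \<xi>' t"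
  have "AE x in m. f (act t x) = \<xi> t * f x" "AE x in m. f (act t x) = \<xi>' t * f x"
    using assms unfolding eigenfunction_def eigenspace_def by auto
  then have "AE x in m. f x = 0" by eventually_elim (use ne in auto)
  then show False using assms(1) unfolding eigenfunction_def by blast
qed

text \<open>
  The product \<open>f \<cdot> cnj e\<close> is invariant, hence constant, and \<open>e \<cdot> cnj e = 1\<close>.
\<close>

lemma eigenspace_one_dimensional:
  assumes \<xi>: "\<xi> \<in> dual_group" and e: "unimodular_eigenfunction \<xi> e" and f: "f \<in> eigenspace act m \<xi>"
  obtains c where "AE x in m. f x = c * e x"
proof -
  have [measurable]: "f \<in> borel_measurable m" and inv: "\<And>t. AE x in m. f (act t x) = \<xi> t * f x"
    using f unfolding eigenspace_def square_integrable_def by auto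
  note [measurable] = unimodular_eigenfunctionD(1)[OF e]
  have "AE x in m. f (act t x) * cnj (e (act t x)) = f x * cnj (e x)" for t
    using inv[of t] unimodular_eigenfunctionD(3)[OF e, of t]
  proof eventually_elim
    case (elim x)
    then have "f (act t x) * cnj (e (act t x)) = (\<xi> t * cnj (\<xi> t)) * (f x * cnj (e x))" by simp
    then show ?case by (simp only: dual_groupD(3)[OF \<xi>] mult_1)
  qed
  moreover have "(\<lambda>x. f x * cnj (e x)) \<in> borel_measurable m" by measurable
  ultimately obtain c where c: "AE x in m. f x * cnj (e x) = c"
    using ergodic unfolding ergodic_measure_def by meson
  then have "AE x in m. f x = c * e x"
  proof eventually_elim
    case (elim x)
    have "f x = f x * (e x * cnj (e x))" by (simp only: unimodular_eigenfunctionD(4)[OF e] mult_1_right)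
    then show ?case using elim by (metis mult.assoc mult.commute)
  qed
  then show thesis by (rule that)
qed

lemma orthonormal_basis_unimodular:
  assumes \<xi>: "\<xi> \<in> dual_group" and e: "unimodular_eigenfunction \<xi> e"
  shows "orthonormal_basis m {e} (eigenspace act m \<xi>)"
  unfolding orthonormal_basis_def
proof (intro conjI ballI allI impI)
  show "{e} \<subseteq> eigenspace act m \<xi>"
    using eigenfunction_unimodular[OF e] unfolding eigenfunction_def by simp
  show "l2_inner m e1 e2 = (if e1 = e2 then 1 else 0)" if "e1 \<in> {e}" "e2 \<in> {e}" for e1 e2
    using that by (simp add: l2_inner_def unimodular_eigenfunctionD(4)[OF e])
  fix f and \<epsilon> :: real assume f: "f \<in> eigenspace act m \<xi>" and "\<epsilon> > 0"
  obtain c where c: "AE x in m. f x = c * e x" using eigenspace_one_dimensional[OF \<xi> e f] .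
  have [measurable]: "f \<in> borel_measurable m"
    using f unfolding eigenspace_def square_integrable_def by auto
  note [measurable] = unimodular_eigenfunctionD(1)[OF e]
  have "(LINT x|m. (cmod (f x - c * e x))\<^sup>2) = (LINT x|m. 0)"
    by (intro integral_cong_AE) (use c in auto)
  then have "l2_norm m (\<lambda>x. f x - (\<Sum>e\<in>{e}. c * e x)) < \<epsilon>"
    using \<open>\<epsilon> > 0\<close> by (simp add: l2_norm_def)
  then show "\<exists>F c. finite F \<and> F \<subseteq> {e} \<and> l2_norm m (\<lambda>x. f x - (\<Sum>e\<in>F. c e * e x)) < \<epsilon>"
    by (intro exI[of _ "{e}"] exI[of _ "\<lambda>_. c"]) simp
qed

text \<open>
  Translating both arguments by \<open>t\<close> preserves the inner product and multiplies it by
  \<open>\<xi> t \<cdot> cnj (\<xi>' t)\<close>, which differs from \<open>1\<close> for some \<open>t\<close>.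
\<close>

lemma unimodular_eigenfunctions_orthogonal:
  assumes "\<xi> \<in> dual_group" "\<xi>' \<in> dual_group" "\<xi> \<noteq> \<xi>'"
    and e: "unimodular_eigenfunction \<xi> e" and e': "unimodular_eigenfunction \<xi>' e'"
  shows "l2_inner m e e' = 0"
proof -
  note [measurable] = unimodular_eigenfunctionD(1)[OF e] unimodular_eigenfunctionD(1)[OF e']
  obtain t where t: "\<xi> t \<noteq> \<xi>' t" using assms(3) by blast
  have "l2_inner m e e' = (LINT x|m. e (act t x) * cnj (e' (act t x)))"
    unfolding l2_inner_def by (rule integral_act[symmetric]) measurable
  also have "\<dots> = (LINT x|m. (\<xi> t * cnj (\<xi>' t)) * (e x * cnj (e' x)))"
  proof (rule integral_cong_AE)
    show "AE x in m. e (act t x) * cnj (e' (act t x)) = (\<xi> t * cnj (\<xi>' t)) * (e x * cnj (e' x))"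
      using unimodular_eigenfunctionD(3)[OF e, of t] unimodular_eigenfunctionD(3)[OF e', of t]
      by eventually_elim simp
  qed measurable
  also have "\<dots> = (\<xi> t * cnj (\<xi>' t)) * l2_inner m e e'"
    unfolding l2_inner_def by simp
  finally have "l2_inner m e e' = (\<xi> t * cnj (\<xi>' t)) * l2_inner m e e'" .
  moreover have "\<xi> t * cnj (\<xi>' t) \<noteq> 1"
  proof
    assume "\<xi> t * cnj (\<xi>' t) = 1"
    then have "\<xi> t * (\<xi>' t * cnj (\<xi>' t)) = \<xi>' t" by (metis mult.left_commute mult_1_right)
    then show False using t dual_groupD(3)[OF assms(2)] by simp
  qed
  ultimately show ?thesis by (metis mult_cancel_right1 mult.commute)
qed

text \<open>
  Expand the nonnegative integral of \<open>\<bar>g - s\<bar>\<^sup>2\<close> where \<open>s\<close> is the orthogonal projection of \<open>g\<close> onto the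
  span of the eigenfunctions.
\<close>

lemma bessel_inequality_unimodular:
  assumes I: "finite I" "I \<subseteq> dual_group" and e: "\<And>\<xi>. \<xi> \<in> I \<Longrightarrow> unimodular_eigenfunction \<xi> (e \<xi>)"
    and g [measurable]: "g \<in> borel_measurable m" and bound: "\<And>x. cmod (g x) \<le> 1"
  shows "(\<Sum>\<xi>\<in>I. (cmod (l2_inner m g (e \<xi>)))\<^sup>2) \<le> 1"
proof -
  note D = unimodular_eigenfunctionD[OF e]
  define a where "a \<xi> = l2_inner m g (e \<xi>)" for \<xi>
  define s where "s x = (\<Sum>\<xi>\<in>I. a \<xi> * e \<xi> x)" for x
  have s_meas [measurable]: "s \<in> borel_measurable m"
    unfolding s_def by (intro borel_measurable_sum borel_measurable_times D(1)) auto
  have s_bound: "cmod (s x) \<le> (\<Sum>\<xi>\<in>I. cmod (a \<xi>))" for x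
    unfolding s_def by (intro sum_norm_le) (simp add: norm_mult D(2))
  have int: "integrable m (\<lambda>x. u x * cnj (v x))"
    if "u \<in> borel_measurable m" "v \<in> borel_measurable m" "\<And>x. cmod (u x) \<le> K" "\<And>x. cmod (v x) \<le> L"
    for u v :: "'x \<Rightarrow> complex" and K L
    using that
    by (intro integrable_bounded[of _ "K * L"])
      (auto simp: norm_mult intro!: mult_mono order_trans[OF norm_ge_zero that(3)])
  have gs: "(LINT x|m. g x * cnj (s x)) = (\<Sum>\<xi>\<in>I. cnj (a \<xi>) * a \<xi>)"
  proof -
    have "(LINT x|m. g x * cnj (s x)) = (LINT x|m. (\<Sum>\<xi>\<in>I. cnj (a \<xi>) * (g x * cnj (e \<xi> x))))"
      by (simp add: s_def sum_distrib_left mult.left_commute)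
    also have "\<dots> = (\<Sum>\<xi>\<in>I. LINT x|m. cnj (a \<xi>) * (g x * cnj (e \<xi> x)))"
      using D(1,2) bound
      by (intro Bochner_Integration.integral_sum integrable_mult_right int[of g _ 1 1]) auto
    also have "\<dots> = (\<Sum>\<xi>\<in>I. cnj (a \<xi>) * a \<xi>)"
      by (simp add: a_def l2_inner_def)
    finally show ?thesis .
  qed
  have es: "(LINT x|m. e \<eta> x * cnj (s x)) = cnj (a \<eta>)" if "\<eta> \<in> I" for \<eta>
  proof -
    have "(LINT x|m. e \<eta> x * cnj (s x)) = (LINT x|m. (\<Sum>\<xi>\<in>I. cnj (a \<xi>) * (e \<eta> x * cnj (e \<xi> x))))"
      by (simp add: s_def sum_distrib_left mult.left_commute)
    also have "\<dots> = (\<Sum>\<xi>\<in>I. LINT x|m. cnj (a \<xi>) * (e \<eta> x * cnj (e \<xi> x)))"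
      using D(1,2) that
      by (intro Bochner_Integration.integral_sum integrable_mult_right int[of _ _ 1 1]) auto
    also have "\<dots> = (\<Sum>\<xi>\<in>I. if \<xi> = \<eta> then cnj (a \<eta>) else 0)"
    proof (rule sum.cong[OF refl])
      fix \<xi> assume \<xi>: "\<xi> \<in> I"
      show "(LINT x|m. cnj (a \<xi>) * (e \<eta> x * cnj (e \<xi> x))) = (if \<xi> = \<eta> then cnj (a \<eta>) else 0)"
        using unimodular_eigenfunctions_orthogonal[OF _ _ _ e[OF that] e[OF \<xi>]] I(2) that \<xi> D(4)[OF that]
        by (auto simp: l2_inner_def)
    qed
    also have "\<dots> = cnj (a \<eta>)" using I(1) that by simp
    finally show ?thesis .
  qed
  have ss: "(LINT x|m. s x * cnj (s x)) = (\<Sum>\<xi>\<in>I. cnj (a \<xi>) * a \<xi>)"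
  proof -
    have "(LINT x|m. s x * cnj (s x)) = (LINT x|m. (\<Sum>\<xi>\<in>I. a \<xi> * (e \<xi> x * cnj (s x))))"
      by (subst (1) s_def) (simp add: sum_distrib_right mult.assoc)
    also have "\<dots> = (\<Sum>\<xi>\<in>I. LINT x|m. a \<xi> * (e \<xi> x * cnj (s x)))"
      using D(1,2) s_bound
      by (intro Bochner_Integration.integral_sum integrable_mult_right int[of _ s 1]) auto
    also have "\<dots> = (\<Sum>\<xi>\<in>I. cnj (a \<xi>) * a \<xi>)"
      by (intro sum.cong) (simp_all add: es)
    finally show ?thesis .
  qed
  let ?b = "\<Sum>\<xi>\<in>I. (cmod (a \<xi>))\<^sup>2"
  have b: "(\<Sum>\<xi>\<in>I. cnj (a \<xi>) * a \<xi>) = complex_of_real ?b"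
    by (simp add: complex_norm_square[symmetric] mult.commute del: of_real_power) 
  have sg: "(LINT x|m. s x * cnj (g x)) = complex_of_real ?b"
  proof -
    have "(LINT x|m. s x * cnj (g x)) = cnj (LINT x|m. g x * cnj (s x))"
      by (simp add: mult.commute flip: Bochner_Integration.integral_cnj)
    then show ?thesis using gs b by simp
  qed
  have "complex_of_real (LINT x|m. (cmod (g x - s x))\<^sup>2)
      = (LINT x|m. (g x - s x) * cnj (g x - s x))"
    by (subst integral_complex_of_real[symmetric]) (simp only: complex_norm_square)
  also have "\<dots> = (LINT x|m. g x * cnj (g x) - g x * cnj (s x) - s x * cnj (g x) + s x * cnj (s x))"
    by (simp add: algebra_simps)
  also have "\<dots> = (LINT x|m. g x * cnj (g x)) - complex_of_real ?b"
    using int[OF g g bound bound] int[OF g s_meas bound s_bound] int[OF s_meas g s_bound bound]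
      int[OF s_meas s_meas s_bound s_bound]
    by (simp add: gs ss sg b)
  also have "(LINT x|m. g x * cnj (g x)) = complex_of_real (LINT x|m. (cmod (g x))\<^sup>2)"
    by (subst integral_complex_of_real[symmetric]) (simp only: complex_norm_square)
  finally have "complex_of_real (LINT x|m. (cmod (g x - s x))\<^sup>2)
      = complex_of_real ((LINT x|m. (cmod (g x))\<^sup>2) - ?b)"
    by (simp only: of_real_diff)
  then have "(LINT x|m. (cmod (g x - s x))\<^sup>2) = (LINT x|m. (cmod (g x))\<^sup>2) - ?b"
    by (simp only: of_real_eq_iff)
  moreover have "0 \<le> (LINT x|m. (cmod (g x - s x))\<^sup>2)" by simp
  moreover have "(LINT x|m. (cmod (g x))\<^sup>2) \<le> (LINT x|m. 1)"
    using bound by (intro integral_mono integrable_bounded[of _ 1]) (auto simp: power_le_one)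
  ultimately show ?thesis by (simp add: a_def)
qed

text \<open>
  Cells generate the Borel sets and are stable under intersection, so by Dynkin's argument a function
  whose integral over every cell vanishes has integral zero over every Borel set.
\<close>

lemma AE_zero_of_basis_cells:
  fixes f :: "'x \<Rightarrow> complex"
  assumes B: "countable B" "topological_basis B" and f: "integrable m f"
    and zero: "\<And>P. P \<in> basis_cells B \<Longrightarrow> (LINT x|m. indicator P x * f x) = 0"
  shows "AE x in m. f x = 0"
proof (rule sigma_finite_measure.density_zero[OF prob_space_imp_sigma_finite[OF prob] f])
  fix S assume "S \<in> sets m"
  then have S: "S \<in> sigma_sets UNIV (basis_cells B)" by (simp add: sigma_sets_basis_cells[OF B])
  have cells: "basis_cells B \<subseteq> Pow UNIV" by simp
  show "set_lebesgue_integral m S f = 0"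
    using Int_stable_basis_cells[of B] cells S
  proof (induct rule: sigma_sets_induct_disjoint)
    case (basic P)
    have "indicator P x *\<^sub>R f x = indicator P x * f x" for x by (simp add: indicator_def)
    then show ?case using zero[OF basic] by (simp add: set_lebesgue_integral_def)
  next
    case (compl S)
    then have S: "S \<in> sets m" by (simp add: sigma_sets_basis_cells[OF B])
    have "set_integrable m T f" if "T \<in> sets m" for T
      using f that by (simp add: set_integrable_def integrable_mult_indicator)
    then have "set_lebesgue_integral m (S \<union> (UNIV - S)) f
        = set_lebesgue_integral m S f + set_lebesgue_integral m (UNIV - S) f"
      using S by (intro set_integral_Un) auto
    moreover have "set_lebesgue_integral m UNIV f = 0"
      using zero[OF basis_cellsI[of "{}" B "{}"]] by (simp add: set_lebesgue_integral_def)
    ultimately show ?case using compl by (simp add: Un_Diff_cancel)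
  next
    case (union S)
    then have "(LINT x:(\<Union>i. S i)|m. f x) = (\<Sum>i. LINT x:(S i)|m. f x)"
      using f by (intro lebesgue_integral_countable_add)
        (auto simp: sigma_sets_basis_cells[OF B] disjoint_family_on_def set_integrable_def
          intro!: integrable_mult_indicator sets.countable_UN)
    then show ?case using union by simp
  qed (simp add: set_lebesgue_integral_def)
qed

text \<open>
  By Bessel's inequality the indicator of a cell is non-orthogonal to only countably many of the
  eigenfunctions, and an eigenfunction orthogonal to the indicators of all cells
  would vanish.  As there are countably many cells, there are countably many eigenvalues.
\<close>

lemma countable_point_spectrum: "countable (point_spectrum act m)"
proof -
  obtain B :: "'x set set" where B: "countable B" "topological_basis B"
    using compact_metrizable_countable_basis[OF compact_phase_space metrizable] .
  obtain e where e: "\<And>\<xi>. \<xi> \<in> point_spectrum act m \<Longrightarrow> unimodular_eigenfunction \<xi> (e \<xi>)"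
    using unimodular_eigenfunction_exists by metis
  have dual: "point_spectrum act m \<subseteq> dual_group" unfolding point_spectrum_def by blast
  define T where "T P = {\<xi>\<in>point_spectrum act m. (cmod (l2_inner m (indicator P) (e \<xi>)))\<^sup>2 \<noteq> 0}" for P
  have "countable (T P)" if "P \<in> basis_cells B" for P
  proof -
    have [measurable]: "P \<in> sets m" using basis_cells_borel[OF B(2) that] by simp
    have "(\<lambda>\<xi>. (cmod (l2_inner m (indicator P) (e \<xi>)))\<^sup>2) summable_on point_spectrum act m"
    proof (rule nonneg_bdd_above_summable_on)
      have "(\<Sum>\<xi>\<in>I. (cmod (l2_inner m (indicator P) (e \<xi>)))\<^sup>2) \<le> 1"
        if "finite I" "I \<subseteq> point_spectrum act m" for I
        using that e dual by (intro bessel_inequality_unimodular) (auto simp: indicator_def)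
      then show "bdd_above (sum (\<lambda>\<xi>. (cmod (l2_inner m (indicator P) (e \<xi>)))\<^sup>2)
          ` {F. F \<subseteq> point_spectrum act m \<and> finite F})"
        by (intro bdd_aboveI2[where M = 1]) auto
    qed simp
    then show ?thesis unfolding T_def by (rule summable_countable_real)
  qed
  moreover have "point_spectrum act m \<subseteq> (\<Union>P\<in>basis_cells B. T P)"
  proof
    fix \<xi> assume \<xi>: "\<xi> \<in> point_spectrum act m"
    note D = unimodular_eigenfunctionD[OF e[OF \<xi>]]
    show "\<xi> \<in> (\<Union>P\<in>basis_cells B. T P)"
    proof (rule ccontr)
      assume "\<xi> \<notin> (\<Union>P\<in>basis_cells B. T P)"
      then have "(LINT x|m. indicator P x * cnj (e \<xi> x)) = 0" if "P \<in> basis_cells B" for P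
        using that \<xi> by (auto simp: T_def l2_inner_def)
      moreover have "integrable m (\<lambda>x. cnj (e \<xi> x))"
        using D(1,2) by (intro integrable_bounded[of _ 1]) auto
      ultimately have "AE x in m. cnj (e \<xi> x) = 0"
        by (intro AE_zero_of_basis_cells[OF B]) auto
      then have "AE x in m. False"
        by eventually_elim (metis D(2) complex_cnj_zero_iff norm_zero zero_neq_one)
      then show False by simp
    qed
  qed
  ultimately show ?thesis
    using countable_basis_cells[OF B(1)] by (meson countable_UN countable_subset)
qed

section \<open>Twisted averages and Wiener--Wintner points\<close>

text \<open>
  The null set in the eigenvalue equation depends on \<open>t\<close>; Fubini's theorem exchanges the two
  quantifiers.
\<close>

lemma AE_orbit_eigenfunction:
  assumes \<xi>: "\<xi> \<in> dual_group" and e: "unimodular_eigenfunction \<xi> e"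
  shows "AE x in m. AE t in \<mu>. e (act t x) = \<xi> t * e x"
proof -
  note [measurable] = unimodular_eigenfunctionD(1)[OF e] dual_groupD(1)[OF \<xi>]
  have sets: "{z \<in> space (\<mu> \<Otimes>\<^sub>M m). e (act (fst z) (snd z)) = \<xi> (fst z) * e (snd z)} \<in> sets (\<mu> \<Otimes>\<^sub>M m)"
    by measurable
  have "AE t in \<mu>. AE x in m. e (act t x) = \<xi> t * e x"
    using unimodular_eigenfunctionD(3)[OF e] by simp
  then show ?thesis
    using AE_commute[where P = "\<lambda>t x. e (act t x) = \<xi> t * e x", OF sets] by blast
qed

lemma continuous_measurable_bounded:
  fixes f :: "'x \<Rightarrow> complex"
  assumes "continuous_on UNIV f"
  obtains K where "f \<in> borel_measurable m" "\<And>x. cmod (f x) \<le> K"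
proof -
  have "bounded (range f)"
    using compact_continuous_image[OF assms compact_phase_space] by (rule compact_imp_bounded)
  then obtain K where "\<And>x. cmod (f x) \<le> K" unfolding bounded_iff by blast
  moreover have "f \<in> borel_measurable m"
    using borel_measurable_continuous_onI[OF assms] by (simp cong: measurable_cong_sets)
  ultimately show thesis by (rule that[rotated])
qed

text \<open>
  Convergence for the indicators of cells passes to their linear combinations, and then to
  continuous functions, because averages and integrals both change by at most \<open>\<epsilon>\<close> when \<open>f\<close> is
  changed uniformly by \<open>\<epsilon>\<close>.  The exceptional set therefore does not depend on \<open>f\<close>.
\<close>

lemma orbit_average_tendsto_continuous:
  assumes B: "topological_basis B"
    and w [measurable]: "w \<in> borel_measurable m" and w_bound: "\<And>y. cmod (w y) \<le> 1"
    and cells: "\<And>P. P \<in> basis_cells B \<Longrightarrow>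
      (\<lambda>n. orbit_average (r n) (\<lambda>y. indicator P y * w y) x) \<longlonglongrightarrow> (LINT y|m. indicator P y * w y)"
    and f: "continuous_on UNIV f"
  shows "(\<lambda>n. orbit_average (r n) (\<lambda>y. f y * w y) x) \<longlonglongrightarrow> (LINT y|m. f y * w y)"
proof (rule LIMSEQ_I)
  fix \<epsilon> :: real assume "\<epsilon> > 0"
  then obtain N :: nat and P a where P: "\<And>i. i < N \<Longrightarrow> P i \<in> basis_cells B"
    and approx: "\<And>x. cmod (f x - (\<Sum>i<N. a i * indicator (P i) x)) \<le> \<epsilon> / 3"
    using continuous_uniform_approx_basis_cells[OF compact_phase_space B f, of "\<epsilon> / 3"] by auto
  obtain K where f_meas [measurable]: "f \<in> borel_measurable m" and K: "\<And>x. cmod (f x) \<le> K"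
    using continuous_measurable_bounded[OF f] by blast
  define s where "s x = (\<Sum>i<N. a i * indicator (P i) x)" for x
  have P_meas: "P i \<in> sets m" if "i < N" for i
    using basis_cells_borel[OF B P[OF that]] by simp
  have s_meas [measurable]: "s \<in> borel_measurable m"
    unfolding s_def by (intro borel_measurable_sum borel_measurable_times borel_measurable_indicator P_meas) auto
  have prod_bound: "cmod (u * w y) \<le> L" if "cmod u \<le> L" for u y L
    using mult_mono[OF that w_bound[of y]] order_trans[OF norm_ge_zero that] by (simp add: norm_mult)
  have s_bound: "cmod (s y) \<le> K + \<epsilon> / 3" for y
    using approx[of y] K[of y] norm_triangle_ineq4[of "f y" "f y - s y"] by (simp add: s_def)
  have cell_bound: "cmod (indicator Q y * w y) \<le> 1" for Q y
    by (rule prod_bound) (simp add: indicator_def)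
  have int: "integrable m (\<lambda>y. u y * w y)" if "u \<in> borel_measurable m" "\<And>y. cmod (u y) \<le> L" for u L
    using that prod_bound by (intro integrable_bounded[of _ L]) auto
  have sint: "set_integrable \<mu> (A n) (\<lambda>t. u (act t x) * w (act t x))"
    if "u \<in> borel_measurable m" "\<And>y. cmod (u y) \<le> L" for u L n
  proof -
    note [measurable] = that(1)
    show ?thesis using that(2) prod_bound by (intro set_integrable_bounded[of _ L]) auto
  qed
  have avg_s: "orbit_average n (\<lambda>y. s y * w y) x = (\<Sum>i<N. a i * orbit_average n (\<lambda>y. indicator (P i) y * w y) x)" for n
  proof -
    have "orbit_average n (\<lambda>y. s y * w y) x
        = set_average \<mu> (A n) (\<lambda>t. \<Sum>i<N. a i * (indicator (P i) (act t x) * w (act t x)))"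
      unfolding orbit_average_def s_def sum_distrib_right mult.assoc ..
    also have "\<dots> = (\<Sum>i<N. set_average \<mu> (A n) (\<lambda>t. a i * (indicator (P i) (act t x) * w (act t x))))"
    proof (rule set_average_sum)
      fix i assume "i \<in> {..<N}"
      then show "set_integrable \<mu> (A n) (\<lambda>t. a i * (indicator (P i) (act t x) * w (act t x)))"
        using P_meas by (intro set_integrable_mult_right sint[of _ 1]) (auto simp: indicator_def)
    qed
    finally show ?thesis by (simp add: set_average_cmult orbit_average_def)
  qed
  have int_s: "(LINT y|m. s y * w y) = (\<Sum>i<N. a i * (LINT y|m. indicator (P i) y * w y))"
  proof -
    have "(LINT y|m. s y * w y) = (LINT y|m. (\<Sum>i<N. a i * (indicator (P i) y * w y)))"
      unfolding s_def sum_distrib_right mult.assoc ..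
    also have "\<dots> = (\<Sum>i<N. LINT y|m. a i * (indicator (P i) y * w y))"
      using P_meas by (intro Bochner_Integration.integral_sum integrable_mult_right int[of _ 1]) (auto simp: indicator_def)
    finally show ?thesis by simp
  qed
  have "(\<lambda>n. orbit_average (r n) (\<lambda>y. s y * w y) x) \<longlonglongrightarrow> (LINT y|m. s y * w y)"
    unfolding avg_s int_s using P by (intro tendsto_intros cells) auto
  from LIMSEQ_D[OF this, of "\<epsilon> / 3"] \<open>\<epsilon> > 0\<close> obtain n0 where
    n0: "\<And>n. n \<ge> n0 \<Longrightarrow> cmod (orbit_average (r n) (\<lambda>y. s y * w y) x - (LINT y|m. s y * w y)) < \<epsilon> / 3"
    by auto
  have fs: "cmod (f y * w y - s y * w y) \<le> \<epsilon> / 3" for y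
    using prod_bound[OF approx[of y], of y] by (simp add: s_def algebra_simps)
  have avg_diff: "cmod (orbit_average n (\<lambda>y. f y * w y) x - orbit_average n (\<lambda>y. s y * w y) x) \<le> \<epsilon> / 3" for n
    using orbit_average_le[of "\<lambda>y. f y * w y - s y * w y" "\<epsilon> / 3" n x] fs
      set_average_diff[OF sint[OF f_meas K] sint[OF s_meas s_bound], of n]
    by (simp add: orbit_average_def)
  have int_diff: "cmod ((LINT y|m. f y * w y) - (LINT y|m. s y * w y)) \<le> \<epsilon> / 3"
  proof -
    have "(LINT y|m. f y * w y) - (LINT y|m. s y * w y) = (LINT y|m. f y * w y - s y * w y)"
      by (rule Bochner_Integration.integral_diff[symmetric]) (rule int[OF f_meas K] int[OF s_meas s_bound])+
    also have "cmod \<dots> \<le> (LINT y|m. cmod (f y * w y - s y * w y))"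
      by (rule integral_norm_bound)
    also have "\<dots> \<le> (LINT y|m. \<epsilon> / 3)"
      using fs \<open>\<epsilon> > 0\<close> by (intro integral_mono integrable_bounded[of _ "\<epsilon> / 3"]) auto
    finally show ?thesis by simp
  qed
  show "\<exists>n0. \<forall>n\<ge>n0. norm (orbit_average (r n) (\<lambda>y. f y * w y) x - (LINT y|m. f y * w y)) < \<epsilon>"
  proof (intro exI allI impI)
    fix n assume "n0 \<le> n"
    from n0[OF this] have "dist (orbit_average (r n) (\<lambda>y. s y * w y) x) (LINT y|m. s y * w y) < \<epsilon> / 3"
      by (simp add: dist_norm)
    moreover have "dist (orbit_average (r n) (\<lambda>y. f y * w y) x) (orbit_average (r n) (\<lambda>y. s y * w y) x) \<le> \<epsilon> / 3"
      using avg_diff by (simp add: dist_norm)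
    moreover have "dist (LINT y|m. s y * w y) (LINT y|m. f y * w y) \<le> \<epsilon> / 3"
      using int_diff by (simp add: dist_norm norm_minus_commute)
    ultimately have "dist (orbit_average (r n) (\<lambda>y. f y * w y) x) (LINT y|m. f y * w y) < \<epsilon>"
      using dist_triangle[of "orbit_average (r n) (\<lambda>y. f y * w y) x" "LINT y|m. f y * w y"
          "orbit_average (r n) (\<lambda>y. s y * w y) x"]
        dist_triangle[of "orbit_average (r n) (\<lambda>y. s y * w y) x" "LINT y|m. f y * w y" "LINT y|m. s y * w y"]
      by linarith
    then show "norm (orbit_average (r n) (\<lambda>y. f y * w y) x - (LINT y|m. f y * w y)) < \<epsilon>"
      by (simp add: dist_norm)
  qed
qed

text \<open>
  On the orbit of \<open>x\<close> one has \<open>cnj (\<xi> t) = e x \<cdot> cnj (e (t.x))\<close>, since \<open>e x \<cdot> cnj (e x) = 1\<close>.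
\<close>

lemma twisted_average_eq:
  assumes \<xi>: "\<xi> \<in> dual_group" and e: "unimodular_eigenfunction \<xi> e"
    and orbit: "AE t in \<mu>. e (act t x) = \<xi> t * e x"
    and f [measurable]: "f \<in> borel_measurable m"
  shows "set_average \<mu> (A n) (\<lambda>t. f (act t x) * cnj (\<xi> t)) = e x * orbit_average n (\<lambda>y. f y * cnj (e y)) x"
proof -
  note [measurable] = unimodular_eigenfunctionD(1)[OF e] dual_groupD(1)[OF \<xi>]
  have "(LINT t:A n|\<mu>. f (act t x) * cnj (\<xi> t)) = (LINT t:A n|\<mu>. e x * (f (act t x) * cnj (e (act t x))))"
    unfolding set_lebesgue_integral_def
  proof (rule integral_cong_AE)
    show "AE t in \<mu>. indicator (A n) t *\<^sub>R (f (act t x) * cnj (\<xi> t)) =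
        indicator (A n) t *\<^sub>R (e x * (f (act t x) * cnj (e (act t x))))"
      using orbit
    proof eventually_elim
      case (elim t)
      have "e x * (f (act t x) * cnj (e (act t x))) = (e x * cnj (e x)) * (f (act t x) * cnj (\<xi> t))"
        using elim by simp
      then show ?case by (simp only: unimodular_eigenfunctionD(4)[OF e] mult_1)
    qed
  qed measurable
  then show ?thesis
    unfolding orbit_average_def set_average_cmult[symmetric] by (simp add: set_average_def)
qed

text \<open>
  The test functions \<open>1\<^sub>P \<cdot> cnj e\<^sub>\<xi>\<close> depend on the action and the measure only; this is
  what allows the same countable family to be used for any subsequence.
\<close>

theorem wiener_wintner_test_functions:
  obtains H where "countable H" "\<And>h. h \<in> H \<Longrightarrow> h \<in> borel_measurable m"
    "\<And>h x. h \<in> H \<Longrightarrow> cmod (h x) \<le> 1"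
    "\<And>r. (\<And>h. h \<in> H \<Longrightarrow> AE x in m. (\<lambda>n. orbit_average (r n) h x) \<longlonglongrightarrow> (LINT y|m. h y)) \<Longrightarrow>
       AE x in m. wiener_wintner_point \<mu> act m (A \<circ> r) x"
proof -
  obtain B :: "'x set set" where B: "countable B" "topological_basis B"
    using compact_metrizable_countable_basis[OF compact_phase_space metrizable] .
  let ?S = "point_spectrum act m"
  obtain e where e: "\<And>\<xi>. \<xi> \<in> ?S \<Longrightarrow> unimodular_eigenfunction \<xi> (e \<xi>)"
    using unimodular_eigenfunction_exists by metis
  have dual: "\<xi> \<in> dual_group" if "\<xi> \<in> ?S" for \<xi> using that unfolding point_spectrum_def by blast
  define H where "H = (\<lambda>(\<xi>, P) x. indicator P x * cnj (e \<xi> x)) ` (?S \<times> basis_cells B)"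
  show thesis
  proof (rule that[of H])
    show "countable H"
      unfolding H_def by (intro countable_image countable_SIGMA countable_point_spectrum countable_basis_cells B)
    show "h \<in> borel_measurable m" if "h \<in> H" for h
    proof -
      obtain \<xi> P where \<xi>: "\<xi> \<in> ?S" and P: "P \<in> basis_cells B" and h: "h = (\<lambda>x. indicator P x * cnj (e \<xi> x))"
        using \<open>h \<in> H\<close> unfolding H_def by auto
      have [measurable]: "P \<in> sets m" using basis_cells_borel[OF B(2) P] by simp
      note [measurable] = unimodular_eigenfunctionD(1)[OF e[OF \<xi>]]
      show ?thesis unfolding h by measurable
    qed
    show "cmod (h x) \<le> 1" if "h \<in> H" for h x
      using that by (auto simp: H_def norm_mult indicator_def unimodular_eigenfunctionD(2)[OF e])
    fix r :: "nat \<Rightarrow> nat"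
    assume conv: "\<And>h. h \<in> H \<Longrightarrow> AE x in m. (\<lambda>n. orbit_average (r n) h x) \<longlonglongrightarrow> (LINT y|m. h y)"
    have "AE x in m. \<forall>h\<in>H. (\<lambda>n. orbit_average (r n) h x) \<longlonglongrightarrow> (LINT y|m. h y)"
      using conv \<open>countable H\<close> by (simp add: AE_ball_countable)
    moreover have "AE x in m. \<forall>\<xi>\<in>?S. AE t in \<mu>. e \<xi> (act t x) = \<xi> t * e \<xi> x"
      using AE_orbit_eigenfunction[OF dual e] countable_point_spectrum by (simp add: AE_ball_countable)
    ultimately show "AE x in m. wiener_wintner_point \<mu> act m (A \<circ> r) x"
    proof eventually_elim
      case (elim x)
      \<comment> \<open>This multiple absorbs the factor \<open>e \<xi> x\<close> that appears in the limit of the twisted averages.\<close>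
      define b where "b \<xi> y = cnj (e \<xi> x) * e \<xi> y" for \<xi> y
      have b: "unimodular_eigenfunction \<xi> (b \<xi>)" if "\<xi> \<in> ?S" for \<xi>
        unfolding b_def using unimodular_eigenfunction_scale[OF e[OF that]]
          unimodular_eigenfunctionD(2)[OF e[OF that]] by simp
      have b_iff: "\<xi>' = \<xi>" if "\<xi> \<in> ?S" "eigenfunction act m \<xi>' (b \<xi>)" for \<xi> \<xi>'
        using eigenfunction_unique_eigenvalue[OF that(2) eigenfunction_unimodular[OF b[OF that(1)]]] .
      show ?case
        unfolding wiener_wintner_point_def
      proof (intro exI[of _ "b ` ?S"] conjI ballI allI impI)
        show "b ` ?S \<subseteq> square_integrable m"
          using eigenfunction_unimodular[OF b] unfolding eigenfunction_def eigenspace_def by auto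
        show "\<exists>\<xi>\<in>dual_group. eigenfunction act m \<xi> u" if "u \<in> b ` ?S" for u
          using that eigenfunction_unimodular[OF b] dual by blast
        show "orthonormal_basis m {u\<in>b ` ?S. eigenfunction act m \<xi> u} (eigenspace act m \<xi>)"
          if "\<xi> \<in> ?S" for \<xi>
        proof -
          have "{u\<in>b ` ?S. eigenfunction act m \<xi> u} = {b \<xi>}"
            using that b_iff eigenfunction_unimodular[OF b] by blast
          then show ?thesis using orthonormal_basis_unimodular[OF dual[OF that] b[OF that]] by simp
        qed
        fix f :: "'x \<Rightarrow> complex" and u \<xi>
        assume f: "continuous_on UNIV f" and "u \<in> b ` ?S" and "eigenfunction act m \<xi> u"
        then have \<xi>: "\<xi> \<in> ?S" and u: "u = b \<xi>" using b_iff by auto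
        have f_meas: "f \<in> borel_measurable m" using continuous_measurable_bounded[OF f] by blast
        note D = unimodular_eigenfunctionD[OF e[OF \<xi>]]
        have "(\<lambda>n. orbit_average (r n) (\<lambda>y. f y * cnj (e \<xi> y)) x) \<longlonglongrightarrow> (LINT y|m. f y * cnj (e \<xi> y))"
        proof (rule orbit_average_tendsto_continuous[OF B(2) _ _ _ f])
          fix P assume "P \<in> basis_cells B"
          then have "(\<lambda>y. indicator P y * cnj (e \<xi> y)) \<in> H"
            using \<xi> unfolding H_def by force
          then show "(\<lambda>n. orbit_average (r n) (\<lambda>y. indicator P y * cnj (e \<xi> y)) x)
              \<longlonglongrightarrow> (LINT y|m. indicator P y * cnj (e \<xi> y))"
            using elim(1) by blast
        qed (use D(1,2) in auto)
        then have "(\<lambda>n. e \<xi> x * orbit_average (r n) (\<lambda>y. f y * cnj (e \<xi> y)) x)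
            \<longlonglongrightarrow> e \<xi> x * (LINT y|m. f y * cnj (e \<xi> y))"
          by (intro tendsto_mult tendsto_const)
        moreover have "e \<xi> x * (LINT y|m. f y * cnj (e \<xi> y)) = l2_inner m f u"
          unfolding l2_inner_def u b_def by (subst integral_mult_right_zero[symmetric]) (simp add: mult.left_commute)
        ultimately show "(\<lambda>n. set_average \<mu> ((A \<circ> r) n) (\<lambda>t. f (act t x) * cnj (\<xi> t))) \<longlonglongrightarrow> l2_inner m f u"
          using twisted_average_eq[OF dual[OF \<xi>] e[OF \<xi>] _ f_meas] elim(2) \<xi> by simp
      qed
    qed
  qed
qed

end

theorem proposition5p7:
  fixes \<mu> :: "'g::{topological_ab_group_add,t2_space} measure"
    and act :: "'g \<Rightarrow> 'x::topological_space \<Rightarrow> 'x"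
    and m :: "'x measure"
    and A :: "nat \<Rightarrow> 'g set"
  assumes "locally_compact_space (euclidean :: 'g topology)"
    and "sigma_compact_space TYPE('g)"
    and "haar_measure \<mu>"
    and "topological_dynamical_system act"
    and "metrizable_space (euclidean :: 'x topology)"
    and "prob_space m"
    and "invariant_measure act m"
    and "ergodic_measure act m"
    and "folner_sequence \<mu> A"
  shows "(pointwise_ergodic_theorem \<mu> act m A \<longrightarrow>
            (AE x in m. wiener_wintner_point \<mu> act m A x)) \<and>
         (\<exists>r :: nat \<Rightarrow> nat. strict_mono r \<and>
            (AE x in m. wiener_wintner_point \<mu> act m (A \<circ> r) x))"
proof -
  interpret ergodic_folner_system \<mu> act m A
    by (rule ergodic_folner_system.intro) (use assms in auto)
  obtain H where H: "countable H" "\<And>h. h \<in> H \<Longrightarrow> h \<in> borel_measurable m"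
      "\<And>h x. h \<in> H \<Longrightarrow> cmod (h x) \<le> 1"
    and ww: "\<And>r. (\<And>h. h \<in> H \<Longrightarrow> AE x in m. (\<lambda>n. orbit_average (r n) h x) \<longlonglongrightarrow> (LINT y|m. h y)) \<Longrightarrow>
       AE x in m. wiener_wintner_point \<mu> act m (A \<circ> r) x"
    using wiener_wintner_test_functions by blast
  show ?thesis
  proof (intro conjI impI)
    assume pet: "pointwise_ergodic_theorem \<mu> act m A"
    have "AE x in m. (\<lambda>n. orbit_average n h x) \<longlonglongrightarrow> (LINT y|m. h y)" if hH: "h \<in> H" for h
    proof -
      obtain X0 where X0: "measure m X0 = 1"
        "\<And>x. x \<in> X0 \<Longrightarrow> (\<lambda>n. set_average \<mu> (A n) (\<lambda>t. h (act t x))) \<longlonglongrightarrow> (LINT x|m. h x)"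
        using pet integrable_bounded[OF H(2)[OF hH] H(3)[OF hH]] unfolding pointwise_ergodic_theorem_def by blast
      have "AE x in m. x \<in> X0" using X0(1) by (rule AE_prob_1)
      then show ?thesis by eventually_elim (simp add: X0(2) orbit_average_def)
    qed
    then show "AE x in m. wiener_wintner_point \<mu> act m A x" using ww[of id] by (simp add: id_def comp_def)
  next
    have "\<exists>r. strict_mono r \<and>
        (\<forall>h\<in>H. AE x in m. (\<lambda>n. orbit_average (r n) h x) \<longlonglongrightarrow> (LINT y|m. h y))"
      by (rule pointwise_ergodic_subsequence[of H 1]) (use H in auto)
    then show "\<exists>r. strict_mono r \<and> (AE x in m. wiener_wintner_point \<mu> act m (A \<circ> r) x)"
      using ww by blast
  qed
qed

end
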